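(* For every integer $g\ge 5$ there exist infinitely many cyclically $5$-edge-connected snarks whose girth equals exactly $g$.
   Context: Graphs are finite; multiple edges and loops are permitted. A snark is a $2$-connected cubic graph that admits no proper $3$-edge-colouring. A cubic graph is cyclically $k$-edge-connected if the removal of fewer than $k$ edges cannot create a graph with at least two components containing circuits. The girth of a graph is the length of a shortest circuit. *)

theory Defs
  imports Main "HOL-Library.Uprod" "HOL-Library.Extended_Nat"
begin

text \<open>Undirected multigraphs. The unordered pair \<open>ends G e\<close> may be diagonal, in which case
  \<open>e\<close> is a loop; distinct edges with the same ends are parallel.\<close>

record ('v, 'e) mgraph =
  verts :: "'v set"
  edges :: "'e set"
  ends :: "'e \<Rightarrow> 'v uprod"

definition finite_mgraph :: "('v, 'e) mgraph \<Rightarrow> bool" where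
  "finite_mgraph G \<longleftrightarrow>
     finite (verts G) \<and> finite (edges G) \<and> (\<forall>e\<in>edges G. set_uprod (ends G e) \<subseteq> verts G)"

definition mgraph_iso :: "('v, 'e) mgraph \<Rightarrow> ('w, 'f) mgraph \<Rightarrow> bool" where
  "mgraph_iso G H \<longleftrightarrow>
     (\<exists>f h. bij_betw f (verts G) (verts H) \<and> bij_betw h (edges G) (edges H) \<and>
            (\<forall>e\<in>edges G. ends H (h e) = map_uprod f (ends G e)))"

text \<open>A loop contributes 2 to the degree of its vertex.\<close>

definition degree :: "('v, 'e) mgraph \<Rightarrow> 'v \<Rightarrow> nat" where
  "degree G v =
     card {e \<in> edges G. v \<in> set_uprod (ends G e)} + card {e \<in> edges G. ends G e = Upair v v}"

definition cubic :: "('v, 'e) mgraph \<Rightarrow> bool" where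
  "cubic G \<longleftrightarrow> finite_mgraph G \<and> (\<forall>v\<in>verts G. degree G v = 3)"

definition delete_edges :: "('v, 'e) mgraph \<Rightarrow> 'e set \<Rightarrow> ('v, 'e) mgraph" where
  "delete_edges G F = G\<lparr>edges := edges G - F\<rparr>"

definition delete_verts :: "('v, 'e) mgraph \<Rightarrow> 'v set \<Rightarrow> ('v, 'e) mgraph" where
  "delete_verts G X =
     G\<lparr>verts := verts G - X, edges := {e \<in> edges G. set_uprod (ends G e) \<inter> X = {}}\<rparr>"

definition adjacency :: "('v, 'e) mgraph \<Rightarrow> ('v \<times> 'v) set" where
  "adjacency G = {(u, v). \<exists>e\<in>edges G. ends G e = Upair u v}"

definition connected_mgraph :: "('v, 'e) mgraph \<Rightarrow> bool" where
  "connected_mgraph G \<longleftrightarrow>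
     verts G \<noteq> {} \<and> (\<forall>u\<in>verts G. \<forall>v\<in>verts G. (u, v) \<in> (adjacency G)\<^sup>*)"

text \<open>Vertex sets of the connected components.\<close>

definition components :: "('v, 'e) mgraph \<Rightarrow> 'v set set" where
  "components G = verts G // {(u, v) \<in> verts G \<times> verts G. (u, v) \<in> (adjacency G)\<^sup>*}"

definition k_connected :: "nat \<Rightarrow> ('v, 'e) mgraph \<Rightarrow> bool" where
  "k_connected k G \<longleftrightarrow>
     k < card (verts G) \<and>
     (\<forall>X \<subseteq> verts G. card X < k \<longrightarrow> connected_mgraph (delete_verts G X))"

text \<open>The circuit through the vertices \<open>vs\<close> in this cyclic order, where the edge \<open>es ! i\<close>
  joins \<open>vs ! i\<close> to its successor. A loop is a circuit of length 1, and a pair of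
  parallel edges between two distinct vertices is a circuit of length 2.\<close>

definition circuit :: "('v, 'e) mgraph \<Rightarrow> 'v list \<Rightarrow> 'e list \<Rightarrow> bool" where
  "circuit G vs es \<longleftrightarrow>
     es \<noteq> [] \<and> length vs = length es \<and> distinct vs \<and> distinct es \<and>
     set vs \<subseteq> verts G \<and> set es \<subseteq> edges G \<and>
     (\<forall>i < length es. ends G (es ! i) = Upair (vs ! i) (vs ! (Suc i mod length vs)))"

text \<open>The girth of a graph without circuits is \<open>\<infinity>\<close>.\<close>

definition girth :: "('v, 'e) mgraph \<Rightarrow> enat" where
  "girth G = Inf {enat (length es) | vs es. circuit G vs es}"

definition cyclically_edge_connected :: "nat \<Rightarrow> ('v, 'e) mgraph \<Rightarrow> bool" where
  "cyclically_edge_connected k G \<longleftrightarrow>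
     (\<forall>F \<subseteq> edges G. card F < k \<longrightarrow>
        \<not> (\<exists>C \<in> components (delete_edges G F). \<exists>D \<in> components (delete_edges G F). C \<noteq> D \<and>
             (\<exists>vs es. circuit (delete_edges G F) vs es \<and> set vs \<subseteq> C) \<and>
             (\<exists>vs es. circuit (delete_edges G F) vs es \<and> set vs \<subseteq> D)))"

text \<open>A loop is incident with itself, so a graph with a loop has no proper edge-colouring.\<close>

definition proper_edge_colouring :: "('v, 'e) mgraph \<Rightarrow> nat \<Rightarrow> ('e \<Rightarrow> nat) \<Rightarrow> bool" where
  "proper_edge_colouring G k c \<longleftrightarrow>
     c ` edges G \<subseteq> {..<k} \<and>
     (\<forall>e\<in>edges G. \<forall>v. ends G e \<noteq> Upair v v) \<and>
     (\<forall>e\<in>edges G. \<forall>f\<in>edges G.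
        e \<noteq> f \<and> set_uprod (ends G e) \<inter> set_uprod (ends G f) \<noteq> {} \<longrightarrow> c e \<noteq> c f)"

definition snark :: "('v, 'e) mgraph \<Rightarrow> bool" where
  "snark G \<longleftrightarrow> cubic G \<and> k_connected 2 G \<and> \<not> (\<exists>c. proper_edge_colouring G 3 c)"

end

theory Submission
  imports Defs "HOL-Library.Z2" "HOL-Library.Product_Plus" "HOL-Library.Nat_Bijection" "HOL-Library.FuncSet"
begin

text \<open>A 3-edge-colouring of a cubic graph is a nowhere-zero flow \<open>f\<close> over the Klein four-group. If a
  vertex of any graph without such a flow is expanded into a subgraph, there is still no flow,
  because the values on the edges leaving the subgraph sum to zero. So it suffices to find a graph
  without a flow, all of whose short circuits pass through vertices of degree at least 5 and all of
  whose cuts with fewer than 5 edges leave these vertices on one side; expanding them into pieces of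
  a cubic graph of large girth and large cyclic connectivity gives a snark of large girth, and a
  circuit of length \<open>g\<close> attached to an expanded vertex makes the girth exactly \<open>g\<close>.

  The graph is assembled from Petersen graphs. Deleting three independent vertices \<open>u, v, y\<close> of the
  Petersen graph so that a tree remains leaves three groups of dangling edges whose sums are not all
  zero. Replace two edges of a second Petersen graph by two such trees, attached along \<open>u\<close> and \<open>v\<close>; the
  ends of the two edges are expanded and the rest of the second graph is a tree again. If both \<open>y\<close>-sums were
  zero, the second Petersen graph would inherit a flow, so the result is a dipole through which a
  nonzero value must pass. Replacing the edges of a hexagon of a third Petersen graph by these
  dipoles makes a flow on it impossible, and the remaining vertices form a claw.\<close>

section \<open>Circuits and cuts in simple graphs\<close>

text \<open>The requirements compete: small pieces control flows but bring short circuits, while a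
  cubic graph of large girth gives no hold on its flows. Expansion separates them. A flow on the
  expanded graph enters only through its values at the ports of each pole and on the skeleton, so
  its absence is a finite propositional question about Petersen graphs, independent of
  \<open>g\<close> and of the pole. A pole enters only through two facts: its small vertex sets can
  be peeled, and a cut with at most 4 edges leaves at most \<open>d + 2\<close> of its vertices on
  one side. As a small set of a pole has twice as many boundary edges as ports, such a cut may be
  assumed to leave each pole whole, and cuts become a finite question as well. A skeleton cut
  separating expanded vertices has at least 5 edges: at least 3 + 2 within one dipole, or 3 in each
  of two dipoles of the hexagon. Poles are cut out of a finite vertex-transitive cubic graph, where
  transitivity converts girth into cyclic connectivity. They have \<open>g + 7\<close> ports but can
  be arbitrarily large, so the orders of the snarks are unbounded.\<close>

definition cut :: "('a \<Rightarrow> 'a set) \<Rightarrow> 'a set \<Rightarrow> ('a \<times> 'a) set" where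
  "cut N A = (SIGMA x:A. N x - A)"

text \<open>A set of vertices contains a circuit iff it contains a core.\<close>

definition core :: "('a \<Rightarrow> 'a set) \<Rightarrow> 'a set \<Rightarrow> bool" where
  "core N Z \<longleftrightarrow> Z \<noteq> {} \<and> (\<forall>x\<in>Z. 2 \<le> card (N x \<inter> Z))"

definition cyclic :: "('a \<Rightarrow> 'a set) \<Rightarrow> 'a set \<Rightarrow> bool" where
  "cyclic N A \<longleftrightarrow> (\<exists>Z\<subseteq>A. core N Z)"

lemma cyclic_mono: "cyclic N A \<Longrightarrow> A \<subseteq> B \<Longrightarrow> cyclic N B"
  unfolding cyclic_def by blast

locale sgraph =
  fixes V :: "'a set" and N :: "'a \<Rightarrow> 'a set"
  assumes fin: "finite V"
    and nbr: "x \<in> V \<Longrightarrow> N x \<subseteq> V"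
    and irr: "x \<in> V \<Longrightarrow> x \<notin> N x"
    and symN: "x \<in> V \<Longrightarrow> y \<in> N x \<Longrightarrow> x \<in> N y"
begin

lemma finN: "x \<in> V \<Longrightarrow> finite (N x)"
  using fin nbr finite_subset by blast

lemma finite_sub: "A \<subseteq> V \<Longrightarrow> finite A"
  using fin finite_subset by blast

lemma finite_cut: "A \<subseteq> V \<Longrightarrow> finite (cut N A)"
  unfolding cut_def using finN finite_sub by (intro finite_SigmaI) auto

lemma card_cut_sum: "A \<subseteq> V \<Longrightarrow> card (cut N A) = (\<Sum>x\<in>A. card (N x - A))"
  unfolding cut_def using finN finite_sub by (intro card_SigmaI) auto

lemma cut_compl: assumes "A \<subseteq> V" shows "card (cut N (V - A)) = card (cut N A)"
proof -
  have "cut N (V - A) = prod.swap ` cut N A"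
  proof (intro set_eqI iffI)
    fix p assume "p \<in> cut N (V - A)"
    then obtain x y where p: "p = (x, y)" "x \<in> V" "x \<notin> A" "y \<in> N x" "y \<in> A"
      unfolding cut_def using nbr by blast
    then have "(y, x) \<in> cut N A" unfolding cut_def using symN by auto
    then show "p \<in> prod.swap ` cut N A" using p by force
  next
    fix p assume "p \<in> prod.swap ` cut N A"
    then obtain x y where p: "p = (y, x)" "x \<in> A" "y \<in> N x" "y \<notin> A" by (auto simp: cut_def)
    then have "x \<in> V" using assms by blast
    then have "y \<in> V" "x \<in> N y" using p nbr symN by blast+
    then show "p \<in> cut N (V - A)" using p by (auto simp: cut_def)
  qed
  then show ?thesis by (simp add: card_image)
qed

text \<open>Twice the number of edges with both ends in \<open>A\<close>.\<close>

definition deg_sum :: "'a set \<Rightarrow> nat" where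
  "deg_sum A = (\<Sum>x\<in>A. card (N x \<inter> A))"

lemma deg_sum_insert:
  assumes "insert x A \<subseteq> V" "x \<notin> A"
  shows "deg_sum (insert x A) = deg_sum A + 2 * card (N x \<inter> A)"
proof -
  have fA: "finite A" using assms finite_sub by blast
  have x0: "card (N x \<inter> insert x A) = card (N x \<inter> A)"
    using irr assms by (intro arg_cong[where f=card]) auto
  have st: "card (N y \<inter> insert x A) = card (N y \<inter> A) + of_bool (y \<in> N x)" if "y \<in> A" for y
  proof (cases "y \<in> N x")
    case True
    then have "N y \<inter> insert x A = insert x (N y \<inter> A)" using symN assms by auto
    then show ?thesis using True fA assms by simp
  next
    case False
    then have "N y \<inter> insert x A = N y \<inter> A" using symN assms that by auto
    then show ?thesis using False by simp
  qed
  have "(\<Sum>y\<in>A. card (N y \<inter> insert x A)) = deg_sum A + (\<Sum>y\<in>A. of_bool (y \<in> N x))"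
    unfolding deg_sum_def by (simp add: st sum.distrib)
  also have "(\<Sum>y\<in>A. of_bool (y \<in> N x)) = card (N x \<inter> A)"
    using fA by (simp add: Int_commute)
  finally show ?thesis
    using assms fA x0 unfolding deg_sum_def by simp
qed

lemma deg_sum_cut:
  assumes "A \<subseteq> V"
  shows "card (cut N A) + deg_sum A = (\<Sum>x\<in>A. card (N x))"
proof -
  have "card (N x) = card (N x - A) + card (N x \<inter> A)" if "x \<in> A" for x
    using card_Int_Diff[of "N x" A] finN[of x] that assms by auto
  then show ?thesis
    unfolding deg_sum_def card_cut_sum[OF assms] by (simp add: sum.distrib)
qed

text \<open>A forest has fewer edges than vertices: a set that is not a core has a vertex with at
  most one neighbour inside, and this vertex can be removed.\<close>

lemma acyclic_deg_sum:
  assumes "A \<subseteq> V" "\<not> cyclic N A" "A \<noteq> {}"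
  shows "deg_sum A + 2 \<le> 2 * card A"
  using finite_sub[OF assms(1)] assms
proof (induction A rule: finite_psubset_induct)
  case (psubset A)
  from psubset.prems have "\<not> core N A" unfolding cyclic_def by blast
  then obtain x where x: "x \<in> A" "card (N x \<inter> A) \<le> 1"
    using psubset.prems(3) unfolding core_def by fastforce
  define B where "B = A - {x}"
  have A: "A = insert x B" "x \<notin> B" using x B_def by auto
  have "card (N x \<inter> B) \<le> card (N x \<inter> A)"
    using psubset.hyps(1) A by (intro card_mono) auto
  then have le: "card (N x \<inter> B) \<le> 1" using x by simp
  have ds: "deg_sum A = deg_sum B + 2 * card (N x \<inter> B)"
    using deg_sum_insert A psubset.prems by auto
  have fB: "finite B" using psubset.hyps B_def by simp
  show ?case
  proof (cases "B = {}")
    case True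
    then show ?thesis using ds A by (simp add: deg_sum_def)
  next
    case False
    have "\<not> cyclic N B" using psubset.prems(2) cyclic_mono[of N B A] unfolding B_def by auto
    then have "deg_sum B + 2 \<le> 2 * card B"
      using psubset.IH[of B] False x(1) psubset.prems(1) unfolding B_def by blast
    then show ?thesis using ds le A fB by simp
  qed
qed

end

locale cubic_sgraph = sgraph +
  assumes cub: "x \<in> V \<Longrightarrow> card (N x) = 3"
begin

text \<open>The degrees sum to \<open>3 * card A\<close>, and the edges of a forest absorb at most
  \<open>2 * card A - 2\<close> of this.\<close>

lemma acyclic_cut:
  assumes "A \<subseteq> V" "\<not> cyclic N A" "A \<noteq> {}"
  shows "card A + 2 \<le> card (cut N A)"
proof -
  have "(\<Sum>x\<in>A. card (N x)) = 3 * card A"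
    using assms cub by (simp add: subset_iff)
  then show ?thesis using acyclic_deg_sum[OF assms] deg_sum_cut[OF assms(1)] by linarith
qed

end

text \<open>In a group of exponent 2 orientations do not matter, so a flow is a symmetric function
  and conservation is a plain sum.\<close>

definition nz_flow :: "'a set \<Rightarrow> ('a \<Rightarrow> 'a set) \<Rightarrow> ('a \<Rightarrow> 'a \<Rightarrow> bit \<times> bit) \<Rightarrow> bool" where
  "nz_flow V N f \<longleftrightarrow>
     (\<forall>x\<in>V. \<forall>y\<in>N x. f x y = f y x \<and> f x y \<noteq> 0) \<and> (\<forall>x\<in>V. (\<Sum>y\<in>N x. f x y) = 0)"

text \<open>The target properties in terms of neighbour sets. \<open>core_card\<close> and
  \<open>has_circuit\<close> bound the girth from both sides; \<open>g3\<close> keeps the closed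
  sequence \<open>u\<close> from running back along an edge.\<close>

locale snark_sgraph = cubic_sgraph +
  fixes g :: nat
  assumes ne: "V \<noteq> {}"
    and cyc5: "A \<subseteq> V \<Longrightarrow> card (cut N A) \<le> 4 \<Longrightarrow> \<not> cyclic N A \<or> \<not> cyclic N (V - A)"
    and noflow: "\<not> nz_flow V N f"
    and core_card: "Z \<subseteq> V \<Longrightarrow> core N Z \<Longrightarrow> g \<le> card Z"
    and has_circuit: "\<exists>u. inj_on u {..<g} \<and> (\<forall>i<g. u i \<in> V \<and> u (Suc i mod g) \<in> N (u i))"
    and g3: "g \<ge> 3"
begin

text \<open>One side of a smaller cut is acyclic, and a nonempty acyclic set has at least 1 + 2
  boundary edges.\<close>

lemma cut_ge3:
  assumes "A \<subseteq> V" "A \<noteq> {}" "A \<noteq> V"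
  shows "3 \<le> card (cut N A)"
proof (rule ccontr)
  assume c: "\<not> 3 \<le> card (cut N A)"
  then consider "\<not> cyclic N A" | "\<not> cyclic N (V - A)" using cyc5 assms by fastforce
  then show False
  proof cases
    case 1
    have "card A > 0" using assms finite_sub by (simp add: card_gt_0_iff)
    then show ?thesis using acyclic_cut[OF assms(1) 1 assms(2)] c by linarith
  next
    case 2
    have ne': "V - A \<noteq> {}" using assms by auto
    have "card (V - A) > 0" using ne' fin by (simp add: card_gt_0_iff)
    then show ?thesis using acyclic_cut[OF _ 2 ne'] cut_compl[OF assms(1)] c by force
  qed
qed

end

section \<open>From neighbour sets to multigraphs\<close>

text \<open>Sorting the ends makes the code symmetric, so an edge of a simple graph becomes a single
  natural number.\<close>

definition edge_code :: "nat \<Rightarrow> nat \<Rightarrow> nat" where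
  "edge_code x y = prod_encode (min x y, max x y)"

definition mgraph_of :: "nat set \<Rightarrow> (nat \<Rightarrow> nat set) \<Rightarrow> (nat, nat) mgraph" where
  "mgraph_of V N = \<lparr>verts = V, edges = {edge_code x y | x y. x \<in> V \<and> y \<in> N x},
     ends = (\<lambda>e. Upair (fst (prod_decode e)) (snd (prod_decode e)))\<rparr>"

lemma edge_code_eq: "edge_code x y = edge_code u v \<longleftrightarrow> (x = u \<and> y = v) \<or> (x = v \<and> y = u)"
  unfolding edge_code_def by (auto simp: min_def max_def split: if_splits)

lemma edge_code_comm: "edge_code x y = edge_code y x"
  by (auto simp: edge_code_eq)

lemma ends_code [simp]: "ends (mgraph_of V N) (edge_code x y) = Upair x y"
  unfolding mgraph_of_def edge_code_def by (auto simp: min_def max_def)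

lemma verts_of [simp]: "verts (mgraph_of V N) = V"
  by (simp add: mgraph_of_def)

lemma edges_of: "edges (mgraph_of V N) = {edge_code x y | x y. x \<in> V \<and> y \<in> N x}"
  by (simp add: mgraph_of_def)

locale nat_snark = snark_sgraph V N g for V :: "nat set" and N and g
begin

abbreviation "G \<equiv> mgraph_of V N"

lemma edge_iff: assumes "x \<in> V" shows "edge_code x y \<in> edges G \<longleftrightarrow> y \<in> N x"
  using assms symN by (auto simp: edges_of edge_code_eq)

lemma edge_ends:
  assumes "e \<in> edges G" "ends G e = Upair x y"
  shows "e = edge_code x y" "x \<in> V" "y \<in> V" "y \<in> N x" "x \<in> N y"
proof -
  obtain u v where e: "e = edge_code u v" "u \<in> V" "v \<in> N u" using assms by (auto simp: edges_of)
  have uv: "v \<in> V" "u \<in> N v" using e nbr symN by blast+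
  have "(x = u \<and> y = v) \<or> (x = v \<and> y = u)" using assms e by (auto simp: Upair_inject)
  then show "e = edge_code x y" "x \<in> V" "y \<in> V" "y \<in> N x" "x \<in> N y"
    using e uv by (auto simp: edge_code_eq)
qed

lemma finite_G: "finite_mgraph G"
proof -
  have "edges G = (\<lambda>(x, y). edge_code x y) ` (SIGMA x:V. N x)" by (auto simp: edges_of)
  then have "finite (edges G)" using fin finN by auto
  moreover have "set_uprod (ends G e) \<subseteq> V" if "e \<in> edges G" for e
  proof -
    obtain x y where "e = edge_code x y" "x \<in> V" "y \<in> N x" using \<open>e \<in> edges G\<close> by (auto simp: edges_of)
    then show ?thesis using nbr[of x] by auto
  qed
  ultimately show ?thesis unfolding finite_mgraph_def using fin by simp
qed

lemma cubic_G: "cubic G"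
  unfolding cubic_def
proof (intro conjI ballI finite_G)
  fix v assume "v \<in> verts G"
  then have v: "v \<in> V" by simp
  have 1: "{e \<in> edges G. v \<in> set_uprod (ends G e)} = edge_code v ` N v"
    using v symN nbr edge_code_comm by (auto simp: edges_of) (metis image_eqI)+
  have 2: "{e \<in> edges G. ends G e = Upair v v} = {}"
    using v edge_ends irr by blast
  have "inj_on (edge_code v) (N v)" by (auto simp: inj_on_def edge_code_eq)
  then show "degree G v = 3"
    unfolding degree_def 1 2 using cub[OF v] by (simp add: card_image)
qed

text \<open>Name the colours by the three nonzero elements of the Klein group. A cubic vertex sees
  each colour once, and these elements sum to 0.\<close>

lemma not_colourable: "\<not> proper_edge_colouring G 3 c"
proof
  assume c: "proper_edge_colouring G 3 c"
  define col :: "nat \<Rightarrow> bit \<times> bit"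
    where "col k = (if k = 0 then (1, 0) else if k = 1 then (0, 1) else (1, 1))" for k
  define f where "f x y = col (c (edge_code x y))" for x y
  have "(\<Sum>y\<in>N x. f x y) = 0" if x: "x \<in> V" for x
  proof -
    let ?h = "\<lambda>y. c (edge_code x y)"
    have inj: "inj_on ?h (N x)"
    proof (rule inj_onI, rule ccontr)
      fix y z assume *: "y \<in> N x" "z \<in> N x" "?h y = ?h z" "y \<noteq> z"
      have "edge_code x y \<in> edges G" "edge_code x z \<in> edges G" using * edge_iff x by auto
      moreover have "edge_code x y \<noteq> edge_code x z" using * by (auto simp: edge_code_eq)
      moreover have "set_uprod (ends G (edge_code x y)) \<inter> set_uprod (ends G (edge_code x z)) \<noteq> {}" by simp
      ultimately show False using c *(3) unfolding proper_edge_colouring_def by metis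
    qed
    have "?h ` N x \<subseteq> {..<3}" using c x edge_iff unfolding proper_edge_colouring_def by blast
    moreover have "card (?h ` N x) = 3" using inj cub[OF x] by (simp add: card_image)
    ultimately have im: "?h ` N x = {..<3}" by (intro card_subset_eq) auto
    have "(\<Sum>y\<in>N x. f x y) = (\<Sum>k\<in>?h ` N x. col k)"
      unfolding f_def by (subst sum.reindex[OF inj]) (simp add: o_def)
    also have "\<dots> = col 0 + col 1 + col 2" unfolding im by (simp add: numeral_3_eq_3 numeral_2_eq_2)
    also have "\<dots> = 0" by (simp add: col_def zero_prod_def)
    finally show ?thesis .
  qed
  moreover have "f x y \<noteq> 0" "f x y = f y x" for x y
    by (auto simp: f_def col_def zero_prod_def edge_code_comm)
  ultimately have "nz_flow V N f" unfolding nz_flow_def by blast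
  with noflow show False by blast
qed

lemma circuit_core:
  assumes "circuit G vs es"
  shows "core N (set vs)" "set vs \<subseteq> V" "card (set vs) = length es"
proof -
  define n where "n = length es"
  have n: "n > 0" "length vs = n" "distinct vs" "distinct es" "set vs \<subseteq> V" "set es \<subseteq> edges G"
    and en: "\<And>i. i < n \<Longrightarrow> ends G (es ! i) = Upair (vs ! i) (vs ! (Suc i mod n))"
    using assms unfolding circuit_def n_def by auto
  show "set vs \<subseteq> V" by fact
  show "card (set vs) = length es" using n n_def by (simp add: distinct_card)
  have ed: "es ! i \<in> edges G" if "i < n" for i using n that n_def by auto
  have "2 \<le> card (N x \<inter> set vs)" if xvs: "x \<in> set vs" for x
  proof -
    obtain i where i: "i < n" "x = vs ! i" using xvs n(2) by (auto simp: in_set_conv_nth)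
    \<comment> \<open>The cyclic predecessor of \<open>i\<close>. Distinctness of vertices and edges
      makes the two neighbours on the circuit distinct, so lengths 1 and 2 do not occur.\<close>
    define j where "j = (if i = 0 then n - 1 else i - 1)"
    have j: "j < n" using i(1) unfolding j_def by auto
    have j': "Suc j mod n = i" using i(1) unfolding j_def by (cases "i = 0") auto
    define y where "y = vs ! (Suc i mod n)"
    define z where "z = vs ! j"
    have 1: "es ! i = edge_code x y" "y \<in> N x"
      using edge_ends[OF ed[OF i(1)] en[OF i(1)]] unfolding i(2) y_def by blast+
    have 2: "es ! j = edge_code z x" "z \<in> N x"
      using edge_ends[OF ed[OF j] en[OF j]] unfolding j' i(2) z_def by blast+
    have "i \<noteq> j"
    proof
      assume "i = j"
      then have "Suc i mod n = i" using j' by simp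
      then have "y = x" using i(2) y_def by simp
      then show False using 1 irr[of x] that n(5) by blast
    qed
    then have "es ! i \<noteq> es ! j" using n(4) i(1) j n_def by (simp add: nth_eq_iff_index_eq)
    then have "y \<noteq> z" using 1 2 edge_code_comm by metis
    moreover have "y \<in> set vs" "z \<in> set vs"
      unfolding y_def z_def using n(1,2) j by simp_all
    ultimately have "{y, z} \<subseteq> N x \<inter> set vs" "card {y, z} = 2" using 1 2 by auto
    then show ?thesis by (metis card_mono finite_Int List.finite_set)
  qed
  moreover have "set vs \<noteq> {}" using n by auto
  ultimately show "core N (set vs)" unfolding core_def by blast
qed

lemma girth_G: "girth G = enat g"
proof -
  obtain u where u: "inj_on u {..<g}" "\<And>i. i < g \<Longrightarrow> u i \<in> V \<and> u (Suc i mod g) \<in> N (u i)"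
    using has_circuit by blast
  define vs where "vs = map u [0..<g]"
  define es where "es = map (\<lambda>i. edge_code (u i) (u (Suc i mod g))) [0..<g]"
  have "inj_on (\<lambda>i. edge_code (u i) (u (Suc i mod g))) {..<g}"
  proof (rule inj_onI)
    fix i j assume ij: "i \<in> {..<g}" "j \<in> {..<g}"
      and e: "edge_code (u i) (u (Suc i mod g)) = edge_code (u j) (u (Suc j mod g))"
    have lt: "Suc i mod g < g" "Suc j mod g < g" using ij by auto
    have "i = j \<or> (i = Suc j mod g \<and> j = Suc i mod g)"
      using e u(1) ij lt unfolding edge_code_eq inj_on_def by auto
    \<comment> \<open>Two positions that succeed each other cyclically would force
      \<open>g \<le> 2\<close>.\<close>
    then show "i = j" using ij g3 by (auto simp: mod_Suc split: if_splits)
  qed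
  then have "circuit G vs es"
    unfolding circuit_def using u g3
    by (auto simp: vs_def es_def distinct_map atLeast0LessThan edges_of)
  moreover have "length es = g" by (simp add: es_def)
  ultimately have mem: "enat g \<in> {enat (length es) | vs es. circuit G vs es}" by blast
  have low: "enat g \<le> x" if "x \<in> {enat (length es) | vs es. circuit G vs es}" for x
  proof -
    obtain vs es where c: "x = enat (length es)" "circuit G vs es" using \<open>x \<in> _\<close> by auto
    then show ?thesis using circuit_core[OF c(2)] core_card[of "set vs"] by simp
  qed
  show ?thesis unfolding girth_def using mem low
    by (intro antisym) (auto intro: Inf_lower Inf_greatest)
qed

text \<open>An edge leaving a component of \<open>G\<close> minus \<open>F\<close> must lie in
  \<open>F\<close>. The cut contains only one of its directions, so the coding is injective.\<close>

lemma component_cut: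
  assumes F: "F \<subseteq> edges G" and C: "C = {w \<in> V. (u, w) \<in> (adjacency (delete_edges G F))\<^sup>*}"
  shows "card (cut N C) \<le> card F"
proof (rule card_inj_on_le)
  show "inj_on (\<lambda>(x, y). edge_code x y) (cut N C)"
    by (auto simp: inj_on_def cut_def edge_code_eq)
  show "finite F" using F finite_G finite_subset unfolding finite_mgraph_def by blast
  show "(\<lambda>(x, y). edge_code x y) ` cut N C \<subseteq> F"
  proof clarify
    fix x y assume "(x, y) \<in> cut N C"
    then have x: "x \<in> V" "x \<in> C" "y \<in> N x" "y \<notin> C" using C by (auto simp: cut_def)
    have yV: "y \<in> V" using x nbr by blast
    show "edge_code x y \<in> F"
    proof (rule ccontr)
      assume "edge_code x y \<notin> F"
      then have "(x, y) \<in> adjacency (delete_edges G F)"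
        using x edge_iff by (auto simp: adjacency_def delete_edges_def intro!: bexI[of _ "edge_code x y"])
      then have "y \<in> C" using x yV C by (auto intro: rtrancl_into_rtrancl)
      then show False using x by simp
    qed
  qed
qed

lemma cyclically_5: "cyclically_edge_connected 5 G"
  unfolding cyclically_edge_connected_def
proof (intro allI impI notI)
  fix F assume F: "F \<subseteq> edges G" "card F < 5"
  let ?H = "delete_edges G F"
  assume "\<exists>C\<in>components ?H. \<exists>D\<in>components ?H. C \<noteq> D \<and>
      (\<exists>vs es. circuit ?H vs es \<and> set vs \<subseteq> C) \<and> (\<exists>vs es. circuit ?H vs es \<and> set vs \<subseteq> D)"
  then obtain C D vs es us fs where CD: "C \<in> components ?H" "D \<in> components ?H" "C \<noteq> D"
    and c: "circuit ?H vs es" "set vs \<subseteq> C" "circuit ?H us fs" "set us \<subseteq> D" by blast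
  let ?R = "{(u, v) \<in> V \<times> V. (u, v) \<in> (adjacency ?H)\<^sup>*}"
  have vH: "verts ?H = V" by (simp add: delete_edges_def)
  have "sym (adjacency ?H)" by (auto simp: sym_def adjacency_def Upair_inject doubleton_eq_iff)
      (metis Upair_inject)
  then have "sym ((adjacency ?H)\<^sup>*)" by (rule sym_rtrancl)
  then have "equiv V ?R"
    unfolding equiv_def refl_on_def trans_def sym_def by (auto intro: rtrancl_trans)
  then have dis: "C \<inter> D = {}" using CD quotient_disj unfolding components_def vH by blast
  obtain u where u: "u \<in> V" "C = ?R `` {u}" using CD unfolding components_def vH by (auto elim: quotientE)
  have Ceq: "C = {w \<in> V. (u, w) \<in> (adjacency ?H)\<^sup>*}" using u by auto
  have DV: "D \<subseteq> V" using CD unfolding components_def vH by (auto elim!: quotientE)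
  have circ: "circuit ?H xs ys \<Longrightarrow> circuit G xs ys" for xs ys
    unfolding circuit_def delete_edges_def by auto
  have "cyclic N C" unfolding cyclic_def
    using circuit_core(1)[OF circ[OF c(1)]] c(2) by (intro exI[of _ "set vs"] conjI)
  moreover have "cyclic N D" unfolding cyclic_def
    using circuit_core(1)[OF circ[OF c(3)]] c(4) by (intro exI[of _ "set us"] conjI)
  then have "cyclic N (V - C)" by (rule cyclic_mono) (use dis DV in auto)
  moreover have "card (cut N C) \<le> 4" using component_cut[OF F(1) Ceq] F(2) by simp
  ultimately show False using cyc5[of C] Ceq by blast
qed

text \<open>If removing at most one vertex separates \<open>C\<close> from \<open>D\<close>, all
  edges of both cuts end in \<open>X\<close>. There are at most 3 of them, but each cut has at least
  3.\<close>

lemma connected_2: "k_connected 2 G"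
  unfolding k_connected_def
proof (intro conjI allI impI)
  obtain x where x: "x \<in> V" using ne by blast
  have "card (N x) \<le> card V" using x nbr fin by (intro card_mono) auto
  then show "2 < card (verts G)" using cub[OF x] by simp
  have c3: "card V \<ge> 3" using \<open>2 < card (verts G)\<close> by simp
  fix X assume X: "X \<subseteq> verts G" "card X < 2"
  let ?H = "delete_verts G X"
  have XV: "X \<subseteq> V" "finite X" using X finite_sub by auto
  have sumX: "(\<Sum>x\<in>X. card (N x)) \<le> 3"
    using X cub XV by (simp add: subset_iff)
  have vH: "verts ?H = V - X" by (simp add: delete_verts_def)
  have "V - X \<noteq> {}"
  proof
    assume "V - X = {}"
    then have "card V \<le> card X" using XV by (intro card_mono) auto
    then show False using c3 X by simp
  qed
  moreover have "(u, v) \<in> (adjacency ?H)\<^sup>*" if uv: "u \<in> V - X" "v \<in> V - X" for u v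
  proof (rule ccontr)
    assume nc: "(u, v) \<notin> (adjacency ?H)\<^sup>*"
    define C where "C = {w \<in> V - X. (u, w) \<in> (adjacency ?H)\<^sup>*}"
    define D where "D = V - X - C"
    have uC: "u \<in> C" "v \<in> D" using uv nc by (auto simp: C_def D_def)
    have sep: "y \<notin> N x" if "x \<in> C" "y \<in> D" for x y
    proof
      assume y: "y \<in> N x"
      have "(x, y) \<in> adjacency ?H"
        using that y edge_iff[of x y] by (auto simp: adjacency_def delete_verts_def C_def D_def intro!: bexI[of _ "edge_code x y"])
      then have "y \<in> C" using that by (auto simp: C_def D_def intro: rtrancl_into_rtrancl)
      then show False using that D_def by simp
    qed
    have sep': "y \<notin> N x" if "x \<in> D" "y \<in> C" for x y
      using sep that symN by (auto simp: C_def D_def)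
    have CV: "C \<subseteq> V" "D \<subseteq> V" "C \<inter> D = {}" "C \<inter> X = {}" "D \<inter> X = {}" by (auto simp: C_def D_def)
    have part: "V = C \<union> D \<union> X" using XV by (auto simp: C_def D_def)
    have "cut N C \<inter> cut N D = {}" using CV by (auto simp: cut_def)
    then have "card (cut N C) + card (cut N D) = card (cut N C \<union> cut N D)"
      using finite_cut CV by (simp add: card_Un_disjoint)
    also have "\<dots> \<le> card (SIGMA x:X. N x)"
    proof (rule card_inj_on_le[where f = prod.swap])
      show "prod.swap ` (cut N C \<union> cut N D) \<subseteq> (SIGMA x:X. N x)"
        using sep sep' CV part symN nbr unfolding cut_def by fastforce
      show "finite (SIGMA x:X. N x)" using XV finN by auto
    qed auto
    also have "\<dots> \<le> 3" using sumX XV finN by (subst card_SigmaI) auto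
    finally have "card (cut N C) + card (cut N D) \<le> 3" .
    moreover have "3 \<le> card (cut N C)" using uC CV by (intro cut_ge3) auto
    moreover have "3 \<le> card (cut N D)" using uC CV by (intro cut_ge3) auto
    ultimately show False by simp
  qed
  ultimately show "connected_mgraph ?H" unfolding connected_mgraph_def vH by blast
qed

lemma snark_G: "snark G"
  unfolding snark_def using cubic_G connected_2 not_colourable by simp

end

section \<open>Submodularity of cut sizes\<close>

context sgraph
begin

text \<open>The inequality holds for the indicator functions at every ordered pair of adjacent
  vertices.\<close>

lemma cut_submodular:
  assumes "A \<subseteq> V" "B \<subseteq> V"
  shows "card (cut N (A \<inter> B)) + card (cut N (A \<union> B)) \<le> card (cut N A) + card (cut N B)"
proof -
  let ?P = "SIGMA x:V. N x"
  let ?i = "\<lambda>X p. of_bool (fst p \<in> X \<and> snd p \<notin> X) :: nat"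
  have fP: "finite ?P" using fin finN by auto
  have c: "card (cut N X) = (\<Sum>p\<in>?P. ?i X p)" if "X \<subseteq> V" for X
  proof -
    have "cut N X = ?P \<inter> {p. fst p \<in> X \<and> snd p \<notin> X}" using that by (auto simp: cut_def)
    then show ?thesis using fP by simp
  qed
  have "(\<Sum>p\<in>?P. ?i (A \<inter> B) p + ?i (A \<union> B) p) \<le> (\<Sum>p\<in>?P. ?i A p + ?i B p)"
    by (intro sum_mono) auto
  moreover have "A \<inter> B \<subseteq> V" "A \<union> B \<subseteq> V" using assms by auto
  ultimately show ?thesis
    unfolding c[OF assms(1)] c[OF assms(2)] c[OF \<open>A \<inter> B \<subseteq> V\<close>] c[OF \<open>A \<union> B \<subseteq> V\<close>]
    by (simp only: sum.distrib)
qed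

text \<open>Submodularity for \<open>A\<close> and the complement of \<open>B\<close>.\<close>

lemma cut_posimodular:
  assumes "A \<subseteq> V" "B \<subseteq> V"
  shows "card (cut N (A - B)) + card (cut N (B - A)) \<le> card (cut N A) + card (cut N B)"
proof -
  have "A \<inter> (V - B) = A - B" "V - (A \<union> (V - B)) = B - A" using assms by auto
  then show ?thesis
    using cut_submodular[of A "V - B"] cut_compl[of B] cut_compl[of "A \<union> (V - B)"] assms by auto
qed

lemma deg_sum_Un:
  assumes "A \<union> B \<subseteq> V" "A \<inter> B = {}"
  shows "deg_sum (A \<union> B) = deg_sum A + deg_sum B + 2 * (\<Sum>a\<in>A. card (N a \<inter> B))"
proof -
  have "finite A" using assms finite_sub by blast
  then show ?thesis using assms
  proof (induction A rule: finite_induct)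
    case empty
    then show ?case by (simp add: deg_sum_def)
  next
    case (insert a A)
    have f: "finite (N a)" using insert.prems finN by auto
    have "card (N a \<inter> (A \<union> B)) = card (N a \<inter> A) + card (N a \<inter> B)"
      using insert.prems f by (subst card_Un_disjoint[symmetric]) (auto intro: arg_cong[where f=card])
    then show ?case
      using insert deg_sum_insert[of a A] deg_sum_insert[of a "A \<union> B"] by auto
  qed
qed

end

section \<open>Cyclic connectivity of vertex-transitive cubic graphs\<close>

text \<open>A cyclic edge cut of minimum size whose side is as small as possible is an atom. Distinct
  atoms are disjoint, so by transitivity every vertex of an atom is incident with an edge of
  its cut; as atoms contain circuits, the cut is as large as the girth.\<close>

locale transitive_cubic = cubic_sgraph +
  fixes r :: nat
  assumes core_gt: "Z \<subseteq> V \<Longrightarrow> core N Z \<Longrightarrow> r < card Z"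
    and conn: "A \<subseteq> V \<Longrightarrow> A \<noteq> {} \<Longrightarrow> cut N A = {} \<Longrightarrow> A = V"
    and transit: "x \<in> V \<Longrightarrow> y \<in> V \<Longrightarrow> \<exists>\<phi>. bij_betw \<phi> V V \<and> \<phi> x = y \<and> (\<forall>z\<in>V. N (\<phi> z) = \<phi> ` N z)"
begin

lemma small_acyclic: "A \<subseteq> V \<Longrightarrow> card A \<le> r \<Longrightarrow> \<not> cyclic N A"
proof
  assume A: "A \<subseteq> V" "card A \<le> r" "cyclic N A"
  then obtain Z where "Z \<subseteq> A" "core N Z" unfolding cyclic_def by blast
  then show False using core_gt[of Z] A card_mono[of A Z] finite_sub[of A] by auto
qed

lemma cyclic_cut_large:
  assumes "A \<subseteq> V" "cyclic N A" "cyclic N (V - A)"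
  shows "r \<le> 4 * card (cut N A)"
proof (rule ccontr)
  assume neg: "\<not> ?thesis"
  define cc where "cc X \<longleftrightarrow> X \<subseteq> V \<and> cyclic N X \<and> cyclic N (V - X)" for X
  define c where "c = (LEAST n. \<exists>X. cc X \<and> card (cut N X) = n)"
  have ex: "\<exists>X. cc X \<and> card (cut N X) = card (cut N A)" using assms cc_def by blast
  have c_le: "c \<le> card (cut N X)" if "cc X" for X
    unfolding c_def using that by (intro Least_le) blast
  have "\<exists>X. cc X \<and> card (cut N X) = c" unfolding c_def by (rule LeastI_ex) (use ex in blast)
  then have ex2: "\<exists>X. cc X \<and> card (cut N X) = c \<and> card X = card X" by blast
  define m where "m = (LEAST n. \<exists>X. cc X \<and> card (cut N X) = c \<and> card X = n)"
  have "\<exists>X. cc X \<and> card (cut N X) = c \<and> card X = m"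
    unfolding m_def by (rule LeastI_ex) (use ex2 in blast)
  then obtain X where X: "cc X" "card (cut N X) = c" "card X = m" by blast
  have m_le: "m \<le> card Y" if "cc Y" "card (cut N Y) = c" for Y
    unfolding m_def using that by (intro Least_le) blast
  have c_small: "4 * c < r" using c_le[of A] assms neg cc_def by simp
  have cc_compl: "cc (V - Y)" if "cc Y" for Y
    using that unfolding cc_def by (auto simp: double_diff)
  have atom: "X = Y" if Y: "cc Y" "card (cut N Y) = c" "card Y = m" and I: "X \<inter> Y \<noteq> {}" for Y
  proof (rule ccontr)
    assume neq: "X \<noteq> Y"
    have sub: "X \<subseteq> V" "Y \<subseteq> V" using X Y cc_def by auto
    have f: "finite X" "finite Y" using sub finite_sub by auto
    have cX: "card X = card (X \<inter> Y) + card (X - Y)" "card Y = card (X \<inter> Y) + card (Y - X)"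
      using card_Int_Diff[OF f(1), of Y] card_Int_Diff[OF f(2), of X] by (simp_all add: Int_commute)
    have I0: "card (X \<inter> Y) > 0" using I f by (simp add: card_gt_0_iff)
    have XY: "X - Y \<noteq> {}"
    proof
      assume "X - Y = {}"
      then have "X \<subseteq> Y" by blast
      then have "X = Y" using X(3) Y(3) by (intro card_subset_eq f(2)) auto
      then show False using neq by blast
    qed
    then have XY0: "card (X - Y) > 0" using f by (simp add: card_gt_0_iff)
    have YX0: "card (Y - X) > 0" using XY0 cX X Y by simp
    then have YX: "Y - X \<noteq> {}" by force
    have pos: "card (cut N (X - Y)) + card (cut N (Y - X)) \<le> 2 * c"
      using cut_posimodular[OF sub] X Y by simp
    have mod: "card (cut N (X \<inter> Y)) + card (cut N (X \<union> Y)) \<le> 2 * c"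
      using cut_submodular[OF sub] X Y by simp
    show False
    proof (cases "cyclic N (X - Y)")
      case True
      \<comment> \<open>Both differences have more than \<open>r\<close> vertices, which makes
        \<open>Y - X\<close> cyclic too. Both cuts then have size at least \<open>c\<close>, by
        posimodularity exactly \<open>c\<close>; but \<open>X - Y\<close> is smaller than an
        atom.\<close>
      then have "card (X - Y) > r" using small_acyclic[of "X - Y"] sub by fastforce
      then have "card (Y - X) > r" using cX X Y by simp
      have "cyclic N (Y - X)"
      proof (rule ccontr)
        assume "\<not> ?thesis"
        then have "card (Y - X) + 2 \<le> card (cut N (Y - X))"
          using acyclic_cut[of "Y - X"] sub YX by auto
        then show False using pos \<open>card (Y - X) > r\<close> c_small by linarith
      qed
      then have "cc (X - Y)" "cc (Y - X)"
        using True sub cyclic_mono[of N "Y - X" "V - (X - Y)"] cyclic_mono[of N "X - Y" "V - (Y - X)"]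
        unfolding cc_def by auto
      then have "card (cut N (X - Y)) = c" using c_le[of "X - Y"] c_le[of "Y - X"] pos by linarith
      then have "m \<le> card (X - Y)" using m_le \<open>cc (X - Y)\<close> by blast
      then show False using cX X I0 by simp
    next
      case False
      then have "card (X - Y) + 2 \<le> card (cut N (X - Y))"
        using acyclic_cut[of "X - Y"] sub XY by auto
      then have le1: "card (X - Y) \<le> 2 * c" using pos by linarith
      \<comment> \<open>Otherwise \<open>X - Y\<close> and \<open>X \<inter> Y\<close> are both
        acyclic with cuts of size at most \<open>2 * c\<close>, so \<open>X\<close> has at most
        \<open>4 * c\<close> vertices. This is the origin of the factor 4.\<close>
      have cI: "cyclic N (X \<inter> Y)"
      proof (rule ccontr)
        assume "\<not> ?thesis"
        then have "card (X \<inter> Y) + 2 \<le> card (cut N (X \<inter> Y))"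
          using acyclic_cut[of "X \<inter> Y"] sub I by auto
        then have "card X \<le> r" using mod le1 cX c_small by linarith
        then show False using small_acyclic X cc_def by blast
      qed
      have ccI: "cc (X \<inter> Y)"
        using cI X sub cyclic_mono[of N "V - X" "V - (X \<inter> Y)"] unfolding cc_def by auto
      have "card (cut N (X \<inter> Y)) \<noteq> c" using m_le[OF ccI] cX X XY0 by auto
      then have lt: "card (cut N (X \<union> Y)) < c" using mod c_le[OF ccI] by linarith
      then have "\<not> cc (X \<union> Y)" using c_le[of "X \<union> Y"] by auto
      then have acy: "\<not> cyclic N (V - (X \<union> Y))"
        using X sub cyclic_mono[of N X "X \<union> Y"] unfolding cc_def by auto
      \<comment> \<open>The complement of an atom competes for the minimum as well. So
        \<open>V - (X \<union> Y)\<close> has at least \<open>card (X \<inter> Y) > r\<close>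
        vertices, too many for an acyclic set with fewer than \<open>c\<close> boundary
        edges.\<close>
      have "m \<le> card (V - X)" using m_le[OF cc_compl[OF X(1)]] cut_compl[OF sub(1)] X by simp
      moreover have "card (V - (X \<union> Y)) = card (V - X) - card (Y - X)"
      proof -
        have "V - (X \<union> Y) = (V - X) - (Y - X)" by auto
        then show ?thesis using fin sub f by (simp add: card_Diff_subset Diff_mono)
      qed
      ultimately have ge: "card (V - (X \<union> Y)) \<ge> card (X \<inter> Y)" using cX Y by linarith
      then have "V - (X \<union> Y) \<noteq> {}" using I0 by fastforce
      then have "card (V - (X \<union> Y)) + 2 \<le> card (cut N (X \<union> Y))"
        using acyclic_cut[OF _ acy] cut_compl[of "X \<union> Y"] sub by auto
      moreover have "card (X \<inter> Y) > r" using small_acyclic[of "X \<inter> Y"] sub cI by fastforce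
      ultimately show False using ge lt c_small by linarith
    qed
  qed
  have XV: "X \<subseteq> V" "cyclic N X" "finite X" using X cc_def finite_sub by auto
  have "X \<noteq> {}" using XV unfolding cyclic_def core_def by auto
  have "X \<noteq> V"
  proof
    assume "X = V"
    then have "cyclic N {}" using X cc_def by simp
    then show False unfolding cyclic_def core_def by auto
  qed
  then have "cut N X \<noteq> {}" using conn XV \<open>X \<noteq> {}\<close> by blast
  then obtain x0 y0 where x0: "x0 \<in> X" "y0 \<in> N x0" "y0 \<notin> X" unfolding cut_def by auto
  \<comment> \<open>An automorphism taking \<open>x0\<close> to \<open>x\<close> maps
    \<open>X\<close> to an atom that meets \<open>X\<close>, hence to \<open>X\<close> itself, and
    so takes the boundary edge at \<open>x0\<close> to one at \<open>x\<close>.\<close>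
  have "N x - X \<noteq> {}" if x: "x \<in> X" for x
  proof -
    obtain \<phi> where "bij_betw \<phi> V V \<and> \<phi> x0 = x \<and> (\<forall>z\<in>V. N (\<phi> z) = \<phi> ` N z)"
      using transit[OF subsetD[OF XV(1) x0(1)] subsetD[OF XV(1) x]] by (rule exE)
    then have \<phi>: "bij_betw \<phi> V V" "\<phi> x0 = x" "\<forall>z\<in>V. N (\<phi> z) = \<phi> ` N z" by simp_all
    have inj: "inj_on \<phi> V" and im: "\<phi> ` V = V" using \<phi> by (auto simp: bij_betw_def)
    have diff: "\<phi> ` (A - B) = \<phi> ` A - \<phi> ` B" if "A \<subseteq> V" "B \<subseteq> V" for A B
      using that by (intro inj_on_image_set_diff[OF inj]) auto
    have core: "core N (\<phi> ` Z)" if Z: "Z \<subseteq> V" "core N Z" for Z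
    proof -
      have "card (N (\<phi> z) \<inter> \<phi> ` Z) = card (N z \<inter> Z)" if "z \<in> Z" for z
      proof -
        have zV: "z \<in> V" using that Z by blast
        have "N (\<phi> z) \<inter> \<phi> ` Z = \<phi> ` (N z \<inter> Z)"
          using \<phi>(3) zV inj_on_image_Int[OF inj nbr[OF zV] Z(1)] by simp
        moreover have "inj_on \<phi> (N z \<inter> Z)" using inj_on_subset[OF inj] Z(1) by blast
        ultimately show ?thesis by (simp add: card_image)
      qed
      then show ?thesis using Z unfolding core_def by auto
    qed
    have cyc: "cyclic N (\<phi> ` A)" if A: "A \<subseteq> V" "cyclic N A" for A
    proof -
      obtain Z where "Z \<subseteq> A" "core N Z" using A(2) unfolding cyclic_def by blast
      then show ?thesis unfolding cyclic_def using core[of Z] A(1) by (intro exI[of _ "\<phi> ` Z"]) auto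
    qed
    have imX: "\<phi> ` X \<subseteq> V" using im XV by blast
    have "cyclic N (\<phi> ` X)" using cyc XV by blast
    moreover have "cyclic N (V - \<phi> ` X)"
      using cyc[of "V - X"] diff[of V X] im X XV cc_def by auto
    ultimately have "cc (\<phi> ` X)" using imX cc_def by blast
    moreover have "card (cut N (\<phi> ` X)) = c"
    proof -
      have "card (N (\<phi> z) - \<phi> ` X) = card (N z - X)" if z: "z \<in> X" for z
      proof -
        have zV: "z \<in> V" using z XV by blast
        have "N (\<phi> z) - \<phi> ` X = \<phi> ` (N z - X)"
          using \<phi>(3) zV diff[OF nbr[OF zV] XV(1)] by simp
        moreover have "inj_on \<phi> (N z - X)" using inj_on_subset[OF inj] nbr[OF zV] by blast
        ultimately show ?thesis by (simp add: card_image)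
      qed
      then have "card (cut N (\<phi> ` X)) = card (cut N X)"
        using inj_on_subset[OF inj XV(1)] XV imX
        by (simp add: card_cut_sum sum.reindex)
      then show ?thesis using X by simp
    qed
    moreover have "card (\<phi> ` X) = m"
      using X XV inj by (simp add: card_image inj_on_subset[OF inj])
    moreover have "X \<inter> \<phi> ` X \<noteq> {}" using x x0 \<phi>(2) by blast
    ultimately have eq: "X = \<phi> ` X" by (rule atom)
    have x0V: "x0 \<in> V" "y0 \<in> V" using x0 XV nbr by blast+
    have "\<phi> y0 \<in> N x" using \<phi> x0 x0V by auto
    moreover have "\<phi> y0 \<notin> \<phi> ` X" using inj x0V x0(3) XV(1) by (meson inj_on_image_mem_iff)
    ultimately show ?thesis using eq by blast
  qed
  then have "1 \<le> card (N x - X)" if "x \<in> X" for x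
    using that finN XV by (simp add: Suc_le_eq card_gt_0_iff subset_iff)
  then have "(\<Sum>x\<in>X. 1) \<le> (\<Sum>x\<in>X. card (N x - X))" by (intro sum_mono) auto
  then have "card X \<le> c" using X card_cut_sum[OF XV(1)] by simp
  moreover have "\<not> card X \<le> r" using small_acyclic[OF XV(1)] XV(2) by blast
  ultimately show False using c_small by linarith
qed

end


section \<open>Poles\<close>

text \<open>A pole has a dangling edge at each of its \<open>d\<close> ports, which counts towards the degree of the port
  in \<open>peel\<close>; so \<open>peel\<close> says that circuits, and paths between ports, have more than \<open>L\<close> vertices.\<close>

locale pole = sgraph W M for W :: "'w set" and M +
  fixes \<pi> :: "nat \<Rightarrow> 'w" and d L :: nat
  assumes port_inj: "inj_on \<pi> {..<d}"
    and port_W: "i < d \<Longrightarrow> \<pi> i \<in> W"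
    and deg: "x \<in> W \<Longrightarrow> card (M x) + of_bool (x \<in> \<pi> ` {..<d}) = 3"
    and peel: "Z \<subseteq> W \<Longrightarrow> Z \<noteq> {} \<Longrightarrow> card Z \<le> L \<Longrightarrow>
      \<exists>z\<in>Z. card (M z \<inter> Z) + of_bool (z \<in> \<pi> ` {..<d}) \<le> 1"
    and small_side: "X \<subseteq> W \<Longrightarrow> card (cut M X) \<le> 4 \<Longrightarrow> card X \<le> d + 2 \<or> card (W - X) \<le> d + 2"
    and dL: "d + 2 \<le> L"
begin

text \<open>Peel the set. A peeled vertex is either a port without remaining neighbours or a
  non-port with at most one, so removing it lowers the left side by at most 3 and the right side by
  exactly 3.\<close>

lemma deg_sum_ports:
  assumes "X \<subseteq> W" "card X \<le> L"
  shows "deg_sum X + 3 * card (X \<inter> \<pi> ` {..<d}) \<le> 3 * card X"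
  using finite_sub[OF assms(1)] assms
proof (induction X rule: finite_psubset_induct)
  case (psubset X)
  let ?P = "\<pi> ` {..<d}"
  show ?case
  proof (cases "X = {}")
    case True
    then show ?thesis by (simp add: deg_sum_def)
  next
    case False
    then obtain z where z: "z \<in> X" "card (M z \<inter> X) + of_bool (z \<in> ?P) \<le> 1"
      using peel psubset.prems by blast
    define Y where "Y = X - {z}"
    have X: "X = insert z Y" "z \<notin> Y" "finite Y" using z psubset.hyps Y_def by auto
    have IH: "deg_sum Y + 3 * card (Y \<inter> ?P) \<le> 3 * card Y"
    proof (rule psubset.IH)
      show "Y \<subset> X" "Y \<subseteq> W" using z psubset.prems Y_def by auto
      show "card Y \<le> L" using X psubset.prems by simp
    qed
    have ds: "deg_sum X = deg_sum Y + 2 * card (M z \<inter> Y)"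
      using deg_sum_insert[of z Y] X psubset.prems by auto
    have "card (M z \<inter> Y) \<le> card (M z \<inter> X)"
      using psubset.hyps(1) X by (intro card_mono) auto
    moreover have "card (X \<inter> ?P) = card (Y \<inter> ?P) + of_bool (z \<in> ?P)"
      using X by auto
    ultimately show ?thesis using IH ds z X by (cases "z \<in> ?P") auto
  qed
qed

text \<open>The degrees in \<open>X\<close> sum to \<open>3 * card X\<close> minus the number of
  ports; subtracting the bound of \<open>deg_sum_ports\<close> leaves at least twice that
  number.\<close>

lemma port_cut:
  assumes "X \<subseteq> W" "card X \<le> L"
  shows "2 * card {i. i < d \<and> \<pi> i \<in> X} \<le> card (cut M X)"
proof -
  let ?P = "\<pi> ` {..<d}"
  have fX: "finite X" using assms finite_sub by blast
  have "X \<inter> ?P = \<pi> ` {i. i < d \<and> \<pi> i \<in> X}" by auto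
  then have pX: "card (X \<inter> ?P) = card {i. i < d \<and> \<pi> i \<in> X}"
    using port_inj by (simp add: card_image inj_on_def)
  have "(\<Sum>x\<in>X. card (M x) + of_bool (x \<in> ?P)) = (\<Sum>x\<in>X. 3)"
    using assms deg by (intro sum.cong refl) blast
  moreover have "(\<Sum>x\<in>X. of_bool (x \<in> ?P)) = card (X \<inter> ?P)"
    using fX by simp
  ultimately have "(\<Sum>x\<in>X. card (M x)) + card (X \<inter> ?P) = 3 * card X"
    by (simp add: sum.distrib)
  then show ?thesis using deg_sum_ports[OF assms] deg_sum_cut[OF assms(1)] pX by linarith
qed

end

section \<open>Poles cut out of vertex-transitive cubic graphs\<close>

context transitive_cubic
begin

lemma small_deg_sum:
  assumes "A \<subseteq> V" "A \<noteq> {}" "card A \<le> r"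
  shows "deg_sum A + 2 \<le> 2 * card A"
  by (rule acyclic_deg_sum[OF assms(1) small_acyclic[OF assms(1,3)] assms(2)])

text \<open>Grow along boundary edges. Sets of at most \<open>r\<close> vertices are acyclic, so a
  new vertex has exactly one neighbour in \<open>Q\<close>. The equation says that \<open>Q\<close>
  spans \<open>k - 1\<close> edges.\<close>

lemma tree_exists:
  assumes "V \<noteq> {}" "1 \<le> k" "k \<le> r"
  shows "\<exists>Q\<subseteq>V. card Q = k \<and> deg_sum Q + 2 = 2 * k"
  using assms(2,3)
proof (induction k rule: nat_induct_at_least)
  case base
  obtain x where "x \<in> V" using assms by blast
  then show ?case using irr by (intro exI[of _ "{x}"]) (auto simp: deg_sum_def)
next
  case (Suc k)
  then obtain Q where Q: "Q \<subseteq> V" "card Q = k" "deg_sum Q + 2 = 2 * k" by auto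
  have fQ: "finite Q" using Q finite_sub by blast
  have "(\<Sum>x\<in>Q. card (N x)) = 3 * k" using Q cub by (simp add: subset_iff)
  then have "card (cut N Q) > 0" using deg_sum_cut[OF Q(1)] Q by linarith
  then have "cut N Q \<noteq> {}" by auto
  then obtain x y where xy: "x \<in> Q" "y \<in> N x" "y \<notin> Q"
    unfolding cut_def by auto
  then have y: "y \<in> V" "x \<in> N y" using Q nbr symN by blast+
  have "card (N y \<inter> Q) > 0" using xy y finN[of y] by (auto simp: card_gt_0_iff)
  moreover have "deg_sum (insert y Q) = deg_sum Q + 2 * card (N y \<inter> Q)"
    using deg_sum_insert[of y Q] xy y Q by auto
  moreover have "deg_sum (insert y Q) + 2 \<le> 2 * card (insert y Q)"
    using small_deg_sum[of "insert y Q"] y Q Suc.prems fQ xy by auto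
  ultimately show ?case
    using y Q xy fQ by (intro exI[of _ "insert y Q"]) auto
qed

text \<open>Deleting a tree on \<open>d - 2\<close> vertices leaves \<open>d\<close> dangling edges.\<close>

lemma pole_exists:
  assumes d: "3 \<le> d" "d + 2 \<le> L" and r: "L + d \<le> r" "16 + 4 * d < r" and ne: "V \<noteq> {}"
  shows "\<exists>(W :: 'a set) M \<pi>. pole W M \<pi> d L \<and> card W + d = card V + 2"
proof -
  define k where "k = d - 2"
  obtain Q where Q: "Q \<subseteq> V" "card Q = k" "deg_sum Q + 2 = 2 * k"
    using tree_exists[of k] ne d r k_def by fastforce
  define W where "W = V - Q"
  define M where "M w = N w - Q" for w
  define P where "P = {w \<in> W. N w \<inter> Q \<noteq> {}}"
  have WV: "W \<subseteq> V" "finite W" "finite Q" using fin Q finite_sub by (auto simp: W_def)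
  have WQ: "W \<inter> Q = {}" by (auto simp: W_def)
  have Q0: "Q \<noteq> {}" using Q d k_def by auto
  \<comment> \<open>Two neighbours in the tree \<open>Q\<close> would close a circuit with at most
    \<open>d - 1\<close> vertices.\<close>
  have N1: "card (N w \<inter> Q) = of_bool (w \<in> P)" if w: "w \<in> W" for w
  proof -
    have "w \<notin> Q" using w by (simp add: W_def)
    then have crd: "card (insert w Q) = k + 1" using WV(3) Q(2) by simp
    then have "deg_sum (insert w Q) + 2 \<le> 2 * card (insert w Q)"
      using w Q WV d r k_def by (intro small_deg_sum) auto
    moreover have "deg_sum (insert w Q) = deg_sum Q + 2 * card (N w \<inter> Q)"
      using deg_sum_insert[of w Q] w WV WQ Q by auto
    ultimately have "card (N w \<inter> Q) \<le> 1" using Q crd by linarith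
    moreover have "card (N w \<inter> Q) = 0 \<longleftrightarrow> w \<notin> P" using w WV finN by (auto simp: P_def)
    ultimately show ?thesis by (cases "w \<in> P") auto
  qed
  have "card P = d"
  proof -
    have "card (cut N Q) = d"
      using deg_sum_cut[OF Q(1)] Q cub d k_def by (simp add: subset_iff)
    then have "d = card (cut N W)" using cut_compl[OF Q(1)] W_def by simp
    also have "\<dots> = (\<Sum>w\<in>W. card (N w \<inter> Q))"
      unfolding card_cut_sum[OF WV(1)]
      using nbr WV(1) by (intro sum.cong refl arg_cong[where f=card]) (auto simp: W_def)
    also have "\<dots> = card P" using N1 WV by (simp add: P_def Int_def)
    finally show ?thesis ..
  qed
  moreover have "finite P" using WV P_def by simp
  ultimately obtain \<pi> where \<pi>: "bij_betw \<pi> {..<d} P"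
    by (metis atLeast0LessThan ex_bij_betw_nat_finite)
  have im: "\<pi> ` {..<d} = P" and inj: "inj_on \<pi> {..<d}" using \<pi> by (auto simp: bij_betw_def)
  have cM: "card (M w) + of_bool (w \<in> P) = 3" if "w \<in> W" for w
  proof -
    have "card (N w) = card (M w) + card (N w \<inter> Q)"
      unfolding M_def using card_Int_Diff[of "N w" Q] finN[of w] that WV by auto
    then show ?thesis using N1 cub that WV by auto
  qed
  interpret W: sgraph W M
  proof
    show "finite W" using WV by simp
    show "M x \<subseteq> W" if "x \<in> W" for x using that nbr WV by (auto simp: M_def W_def)
    show "x \<notin> M x" if "x \<in> W" for x using that irr WV by (auto simp: M_def)
    show "x \<in> M y" if "x \<in> W" "y \<in> M x" for x y
      using that symN WV WQ by (auto simp: M_def W_def)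
  qed
  have "pole W M \<pi> d L"
  proof
    show "inj_on \<pi> {..<d}" by fact
    show "\<pi> i \<in> W" if "i < d" for i using that im P_def by auto
    show "card (M x) + of_bool (x \<in> \<pi> ` {..<d}) = 3" if "x \<in> W" for x using cM that im by simp
    show "d + 2 \<le> L" by fact
    show "\<exists>z\<in>Z. card (M z \<inter> Z) + of_bool (z \<in> \<pi> ` {..<d}) \<le> 1"
      if Z: "Z \<subseteq> W" "Z \<noteq> {}" "card Z \<le> L" for Z
    proof (rule ccontr)
      \<comment> \<open>\<open>Z \<union> Q\<close> is small, hence a forest. Comparing its edge
        count with the degrees forced in \<open>Z\<close> shows that \<open>Z\<close> contains no
        port, so \<open>Z\<close> is itself a core, against the girth.\<close>
      assume neg: "\<not> ?thesis"
      have ge: "2 \<le> card (M z \<inter> Z) + of_bool (z \<in> P)" if "z \<in> Z" for z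
      proof -
        have "\<not> card (M z \<inter> Z) + of_bool (z \<in> P) \<le> 1" using neg that im by blast
        then show ?thesis by linarith
      qed
      have fZ: "finite Z" using Z WV finite_subset by blast
      have MN: "M z \<inter> Z = N z \<inter> Z" for z using Z WQ by (auto simp: M_def)
      have ZQ: "Z \<inter> Q = {}" using Z WQ by auto
      have sub: "Z \<union> Q \<subseteq> V" using Z WV Q by auto
      have crd: "card (Z \<union> Q) = card Z + k" using ZQ fZ WV Q by (simp add: card_Un_disjoint)
      have "deg_sum (Z \<union> Q) + 2 \<le> 2 * card (Z \<union> Q)"
        using small_deg_sum[OF sub] Q0 crd Z r k_def by auto
      moreover have "deg_sum (Z \<union> Q) = deg_sum Z + deg_sum Q + 2 * (\<Sum>z\<in>Z. card (N z \<inter> Q))"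
        using deg_sum_Un[OF sub ZQ] .
      moreover have "(\<Sum>z\<in>Z. card (N z \<inter> Q)) = (\<Sum>z\<in>Z. of_bool (z \<in> P))"
        using N1 Z by (intro sum.cong) auto
      moreover have "2 * card Z \<le> deg_sum Z + (\<Sum>z\<in>Z. of_bool (z \<in> P))"
      proof -
        have "(\<Sum>z\<in>Z. 2) \<le> (\<Sum>z\<in>Z. card (M z \<inter> Z) + of_bool (z \<in> P))"
          by (intro sum_mono ge)
        then show ?thesis unfolding deg_sum_def MN by (simp add: sum.distrib)
      qed
      ultimately have "(\<Sum>z\<in>Z. of_bool (z \<in> P)) = (0::nat)" using Q crd by linarith
      then have "\<And>z. z \<in> Z \<Longrightarrow> z \<notin> P" using fZ by auto
      then have "2 \<le> card (N z \<inter> Z)" if "z \<in> Z" for z using ge[OF that] that MN by simp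
      then have "core N Z" unfolding core_def using Z(2) by blast
      then show False using core_gt[of Z] Z WV r by auto
    qed
    show "card X \<le> d + 2 \<or> card (W - X) \<le> d + 2" if X: "X \<subseteq> W" "card (cut M X) \<le> 4" for X
    proof -
      have XV: "X \<subseteq> V" "finite X" using X WV finite_subset by auto
      have "card (N x - X) = card (M x - X) + of_bool (x \<in> P)" if x: "x \<in> X" for x
      proof -
        have "N x - X = (M x - X) \<union> (N x \<inter> Q)" "(M x - X) \<inter> (N x \<inter> Q) = {}"
          using X WQ by (auto simp: M_def)
        moreover have "finite (N x)" using x XV finN by blast
        ultimately have "card (N x - X) = card (M x - X) + card (N x \<inter> Q)"
          by (simp add: card_Un_disjoint M_def)
        then show ?thesis using N1 x X by auto
      qed
      then have "card (cut N X) = card (cut M X) + card (X \<inter> P)"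
        using XV by (simp add: card_cut_sum[OF XV(1)] W.card_cut_sum[OF X(1)] sum.distrib)
      moreover have "card (X \<inter> P) \<le> d"
        using \<open>card P = d\<close> \<open>finite P\<close> card_mono[of P "X \<inter> P"] by auto
      ultimately have cut: "card (cut N X) \<le> 4 + d" using X by linarith
      \<comment> \<open>Here \<open>16 + 4 * d < r\<close> is used: it is 4 times the cut size
        \<open>4 + d\<close>. The acyclic side then has at most \<open>4 + d - 2\<close> vertices,
        the bound in \<open>small_side\<close>.\<close>
      have "\<not> cyclic N X \<or> \<not> cyclic N (V - X)" using cyclic_cut_large[of X] cut XV r by linarith
      then show ?thesis
      proof
        assume "\<not> cyclic N X"
        then show ?thesis using acyclic_cut[of X] XV cut by (cases "X = {}") auto
      next
        assume a: "\<not> cyclic N (V - X)"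
        have "card (W - X) \<le> card (V - X)" using WV fin by (intro card_mono) auto
        moreover have "card (V - X) \<le> d + 2"
        proof (cases "V - X = {}")
          case True
          then show ?thesis by (simp only: card.empty)
        next
          case False
          then have "card (V - X) + 2 \<le> card (cut N (V - X))" by (intro acyclic_cut a) auto
          then show ?thesis using cut_compl[OF XV(1)] cut by linarith
        qed
        ultimately show ?thesis by linarith
      qed
    qed
  qed
  moreover have "card W + d = card V + 2"
    using card_Diff_subset[OF WV(3) Q(1)] Q(2) card_mono[OF fin Q(1)] k_def d W_def by simp
  ultimately show ?thesis by blast
qed

end

section \<open>Cubic Cayley graphs of large girth\<close>

text \<open>Letters act on the reduced words of length at most \<open>r\<close> by prepending and cancelling; words
  of length at most \<open>r\<close> are recovered from their action on the empty word.\<close>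

definition ball :: "nat \<Rightarrow> nat list set" where
  "ball r = {xs. set xs \<subseteq> {..<3} \<and> distinct_adj xs \<and> length xs \<le> r}"

text \<open>Lists outside the ball, and words of full length that do not start with
  \<open>k\<close>, are fixed; this makes each letter an involution on the whole type.\<close>

definition letter :: "nat \<Rightarrow> nat \<Rightarrow> nat list \<Rightarrow> nat list" where
  "letter r k xs = (if xs \<notin> ball r then xs else if xs \<noteq> [] \<and> hd xs = k then tl xs
     else if length xs < r then k # xs else xs)"

definition word :: "nat \<Rightarrow> nat list \<Rightarrow> nat list \<Rightarrow> nat list" where
  "word r ks = foldr (\<lambda>k f. letter r k \<circ> f) ks id"

definition word_group :: "nat \<Rightarrow> (nat list \<Rightarrow> nat list) set" where
  "word_group r = word r ` {ks. set ks \<subseteq> {..<3}}"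

text \<open>Generators multiply on the right, so left multiplications are automorphisms.\<close>

definition cayley :: "nat \<Rightarrow> (nat list \<Rightarrow> nat list) \<Rightarrow> (nat list \<Rightarrow> nat list) set" where
  "cayley r v = (\<lambda>k. v \<circ> letter r k) ` {..<3}"

lemma word_simps [simp]: "word r [] = id" "word r (k # ks) = letter r k \<circ> word r ks"
  by (simp_all add: word_def)

lemma word_append: "word r (ks @ ls) = word r ks \<circ> word r ls"
  by (induction ks) (simp_all add: o_assoc)

lemma finite_ball: "finite (ball r)"
  by (rule finite_subset[OF _ finite_lists_length_le[of "{..<3}" r]]) (auto simp: ball_def)

lemma letter_ball:
  assumes "k < 3" "xs \<in> ball r"
  shows "letter r k xs \<in> ball r"
proof (cases xs)
  case Nil
  then show ?thesis using assms by (simp add: letter_def ball_def)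
next
  case (Cons y ys)
  then show ?thesis using assms by (cases ys) (simp_all add: letter_def ball_def)
qed

lemma letter_letter:
  assumes "k < 3" "r \<ge> 1"
  shows "letter r k (letter r k xs) = xs"
proof (cases "xs \<in> ball r")
  case False
  then show ?thesis by (simp add: letter_def)
next
  case True
  note B = letter_ball[OF assms(1) True]
  show ?thesis
  proof (cases xs)
    case Nil
    then show ?thesis using True B assms by (auto simp: letter_def)
  next
    case (Cons y ys)
    show ?thesis
    proof (cases "y = k")
      case True
      then have "letter r k xs = ys" using \<open>xs \<in> ball r\<close> Cons by (simp add: letter_def)
      moreover have "\<not> (ys \<noteq> [] \<and> hd ys = k)" "length ys < r"
        using \<open>xs \<in> ball r\<close> Cons True by (cases ys; auto simp: ball_def)+
      ultimately show ?thesis using B Cons True by (auto simp: letter_def)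
    next
      case False
      then show ?thesis using \<open>xs \<in> ball r\<close> B Cons by (auto simp: letter_def)
    qed
  qed
qed

lemma word_rev:
  assumes "set ks \<subseteq> {..<3}" "r \<ge> 1"
  shows "word r (rev ks) \<circ> word r ks = id"
  using assms
proof (induction ks)
  case (Cons k ks)
  have "letter r k \<circ> letter r k = id" using letter_letter Cons.prems by auto
  moreover have "word r (rev (k # ks)) \<circ> word r (k # ks)
      = word r (rev ks) \<circ> (letter r k \<circ> letter r k) \<circ> word r ks"
    by (simp add: word_append o_assoc)
  ultimately have "word r (rev (k # ks)) \<circ> word r (k # ks) = word r (rev ks) \<circ> word r ks"
    by (simp only: comp_id)
  also have "\<dots> = id" by (rule Cons.IH) (use Cons.prems in auto)
  finally show ?case .
qed simp

lemma word_rev': "set ks \<subseteq> {..<3} \<Longrightarrow> r \<ge> 1 \<Longrightarrow> word r ks \<circ> word r (rev ks) = id"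
  using word_rev[of "rev ks" r] by simp

lemma word_Nil: "ks \<in> ball r \<Longrightarrow> word r ks [] = ks"
proof (induction ks)
  case (Cons k ks)
  then have "ks \<in> ball r" "length ks < r" "\<not> (ks \<noteq> [] \<and> hd ks = k)"
    by (cases ks; auto simp: ball_def)+
  then show ?case using Cons by (auto simp: letter_def)
qed simp

text \<open>Group elements fix every list outside the finite ball and map the ball into itself, so
  their restrictions to the ball determine them.\<close>

lemma finite_word_group: "finite (word_group r)"
proof -
  have out: "word r ks xs = xs" if "xs \<notin> ball r" for ks xs
    using that by (induction ks) (auto simp: letter_def)
  have inb: "word r ks xs \<in> ball r" if "set ks \<subseteq> {..<3}" "xs \<in> ball r" for ks xs
    using that by (induction ks) (auto intro: letter_ball)
  have "inj_on (\<lambda>f. restrict f (ball r)) (word_group r)"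
  proof (rule inj_onI)
    fix f h assume fh: "f \<in> word_group r" "h \<in> word_group r" "restrict f (ball r) = restrict h (ball r)"
    show "f = h"
    proof
      fix xs
      show "f xs = h xs"
      proof (cases "xs \<in> ball r")
        case True
        then show ?thesis using fun_cong[OF fh(3), of xs] by simp
      next
        case False
        then show ?thesis using fh(1,2) out by (auto simp: word_group_def)
      qed
    qed
  qed
  moreover have "(\<lambda>f. restrict f (ball r)) ` word_group r \<subseteq> ball r \<rightarrow>\<^sub>E ball r"
    using inb by (auto simp: word_group_def)
  ultimately show ?thesis
    using finite_PiE[OF finite_ball, of r "\<lambda>_. ball r"] finite_ball inj_on_finite by blast
qed

locale cayley_graph =
  fixes r :: nat
  assumes r2: "r \<ge> 2"
begin

lemma gen_mem:
  assumes "v \<in> word_group r" "k < 3"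
  shows "v \<circ> letter r k \<in> word_group r"
proof -
  obtain ks where ks: "v = word r ks" "set ks \<subseteq> {..<3}" using assms(1) by (auto simp: word_group_def)
  then have "v \<circ> letter r k = word r (ks @ [k])" by (simp add: word_append)
  moreover have "set (ks @ [k]) \<subseteq> {..<3}" using ks assms by auto
  ultimately show ?thesis unfolding word_group_def by blast
qed

lemma inj_word: "v \<in> word_group r \<Longrightarrow> inj v"
proof -
  assume "v \<in> word_group r"
  then obtain ks where ks: "v = word r ks" "set ks \<subseteq> {..<3}" by (auto simp: word_group_def)
  then show "inj v" using word_rev[OF ks(2)] r2 by (intro inj_on_inverseI[of _ "word r (rev ks)"]) (auto simp: fun_eq_iff)
qed

lemma gen_cancel:
  assumes "v \<in> word_group r" "v \<circ> f = v \<circ> h"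
  shows "f = h"
proof
  fix x
  have "v (f x) = v (h x)" using fun_cong[OF assms(2), of x] by simp
  then show "f x = h x" using inj_word[OF assms(1)] by (simp add: inj_eq)
qed

lemma letter_Nil: "letter r k [] = [k]"
  using r2 by (simp add: letter_def ball_def)

lemma letter_inj: assumes "letter r j = letter r k" shows "j = k"
  using fun_cong[OF assms, of "[]"] unfolding letter_Nil by simp

text \<open>In a core one can walk on forever without reversing a step. At most \<open>r\<close>
  consecutive letters of the walk form a reduced word, which is not the identity unless empty, so
  the first \<open>r + 1\<close> vertices are distinct.\<close>

lemma core_large:
  assumes Z: "Z \<subseteq> word_group r" "core (cayley r) Z"
  shows "r < card Z"
proof -
  have step: "\<exists>j<3. j \<noteq> k \<and> z \<circ> letter r j \<in> Z" if "z \<in> Z" for z k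
  proof (rule ccontr)
    assume neg: "\<not> ?thesis"
    have "cayley r z \<inter> Z \<subseteq> {z \<circ> letter r k}" using neg by (auto simp: cayley_def)
    then have "card (cayley r z \<inter> Z) \<le> card {z \<circ> letter r k}" by (intro card_mono) auto
    then show False using Z(2) that unfolding core_def by fastforce
  qed
  obtain z0 where z0: "z0 \<in> Z" using Z(2) unfolding core_def by blast
  have "\<exists>f. \<forall>n. (fst (f n) \<in> Z \<and> snd (f n) < 3 \<and> fst (f n) \<circ> letter r (snd (f n)) \<in> Z) \<and>
      (fst (f (Suc n)) = fst (f n) \<circ> letter r (snd (f n)) \<and> snd (f (Suc n)) \<noteq> snd (f n))"
  proof (rule dependent_nat_choice)
    obtain j where "j < 3" "z0 \<circ> letter r j \<in> Z" using step[OF z0, of 0] by blast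
    then show "\<exists>x. fst x \<in> Z \<and> snd x < 3 \<and> fst x \<circ> letter r (snd x) \<in> Z"
      using z0 by (intro exI[of _ "(z0, j)"]) auto
  next
    fix x :: "(nat list \<Rightarrow> nat list) \<times> nat" and n :: nat
    assume x: "fst x \<in> Z \<and> snd x < 3 \<and> fst x \<circ> letter r (snd x) \<in> Z"
    then obtain j where "j < 3" "j \<noteq> snd x" "(fst x \<circ> letter r (snd x)) \<circ> letter r j \<in> Z"
      using step[of "fst x \<circ> letter r (snd x)" "snd x"] by blast
    then show "\<exists>y. (fst y \<in> Z \<and> snd y < 3 \<and> fst y \<circ> letter r (snd y) \<in> Z) \<and>
        (fst y = fst x \<circ> letter r (snd x) \<and> snd y \<noteq> snd x)"
      using x by (intro exI[of _ "(fst x \<circ> letter r (snd x), j)"]) auto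
  qed
  then obtain f where f: "\<And>n. fst (f n) \<in> Z" "\<And>n. snd (f n) < 3"
    "\<And>n. fst (f (Suc n)) = fst (f n) \<circ> letter r (snd (f n))" "\<And>n. snd (f (Suc n)) \<noteq> snd (f n)"
    by blast
  define w where "w i n = map (\<lambda>j. snd (f (i + j))) [0..<n]" for i n
  have adv: "fst (f (i + n)) = fst (f i) \<circ> word r (w i n)" for i n
    by (induction n) (simp_all add: w_def f(3) word_append o_assoc)
  have wb: "w i n \<in> ball r" if "n \<le> r" for i n
    using that f(2) f(4)[symmetric] by (auto simp: ball_def w_def distinct_adj_conv_nth)
  have ne: "fst (f (i + n)) \<noteq> fst (f i)" if "1 \<le> n" "n \<le> r" for i n
  proof
    assume "fst (f (i + n)) = fst (f i)"
    then have "fst (f i) \<circ> word r (w i n) = fst (f i) \<circ> id" using adv by simp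
    then have "word r (w i n) = id" by (rule gen_cancel[OF subsetD[OF Z(1) f(1)]])
    then have "w i n = []" using word_Nil[OF wb[OF that(2)], of i] by simp
    then show False using that by (simp add: w_def)
  qed
  have "inj_on (\<lambda>i. fst (f i)) {..r}"
  proof (rule linorder_inj_onI)
    fix i j assume "i < j" "i \<in> {..r}" "j \<in> {..r}"
    then have "1 \<le> j - i" "j - i \<le> r" "i + (j - i) = j" by auto
    then show "fst (f i) \<noteq> fst (f j)" using ne[of "j - i" i] by metis
  qed auto
  moreover have "finite Z" using Z(1) finite_word_group by (rule finite_subset)
  ultimately have "card {..r} \<le> card Z"
    using f(1) by (intro card_inj_on_le) auto
  then show ?thesis by simp
qed

sublocale transitive_cubic "word_group r" "cayley r" r
proof
  show "finite (word_group r)" by (rule finite_word_group)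
  show "cayley r x \<subseteq> word_group r" if "x \<in> word_group r" for x
    using that gen_mem by (auto simp: cayley_def)
  show "x \<notin> cayley r x" if x: "x \<in> word_group r" for x
  proof
    assume "x \<in> cayley r x"
    then obtain k where "x = x \<circ> letter r k" by (auto simp: cayley_def)
    then have "x \<circ> letter r k = x \<circ> id" by simp
    then have "letter r k = id" by (rule gen_cancel[OF x])
    then show False using letter_Nil[of k] by simp
  qed
  show "x \<in> cayley r y" if xy: "x \<in> word_group r" "y \<in> cayley r x" for x y
  proof -
    obtain k where k: "k < 3" "y = x \<circ> letter r k" using xy by (auto simp: cayley_def)
    have "letter r k \<circ> letter r k = id" using letter_letter[OF k(1)] r2 by auto
    then have "x = y \<circ> letter r k" using k by (simp add: o_assoc[symmetric])
    then show ?thesis using k by (auto simp: cayley_def)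
  qed
  show "card (cayley r x) = 3" if "x \<in> word_group r" for x
  proof -
    have "inj_on (\<lambda>k. x \<circ> letter r k) {..<3}"
      using gen_cancel[OF that] letter_inj by (auto simp: inj_on_def)
    then show ?thesis unfolding cayley_def by (simp add: card_image)
  qed
  show "r < card Z" if "Z \<subseteq> word_group r" "core (cayley r) Z" for Z
    using core_large that by blast
  show "A = word_group r" if A: "A \<subseteq> word_group r" "A \<noteq> {}" "cut (cayley r) A = {}" for A
  proof -
    obtain a where "a \<in> A" using A(2) by blast
    moreover then obtain ks where "a = word r ks" "set ks \<subseteq> {..<3}"
      using A(1) unfolding word_group_def by blast
    ultimately have a: "a \<in> A" "a = word r ks" "set ks \<subseteq> {..<3}" by blast+
    have cl: "v \<circ> letter r k \<in> A" if "v \<in> A" "k < 3" for v k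
      using A(3) that by (auto simp: cut_def cayley_def)
    have "v \<circ> word r ls \<in> A" if "v \<in> A" "set ls \<subseteq> {..<3}" for v ls
      using that by (induction ls arbitrary: v) (auto simp: o_assoc cl)
    then have "a \<circ> word r (rev ks @ ls) \<in> A" if "set ls \<subseteq> {..<3}" for ls
      using a that by auto
    moreover have "a \<circ> word r (rev ks @ ls) = word r ls" for ls
      using word_rev'[OF a(3)] r2 unfolding a(2) word_append by (simp add: o_assoc)
    ultimately show ?thesis using A(1) by (auto simp: word_group_def)
  qed
  show "\<exists>\<phi>. bij_betw \<phi> (word_group r) (word_group r) \<and> \<phi> x = y \<and>
      (\<forall>z\<in>word_group r. cayley r (\<phi> z) = \<phi> ` cayley r z)"
    if xy: "x \<in> word_group r" "y \<in> word_group r" for x y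
  proof -
    obtain ks ls where ks: "x = word r ks" "set ks \<subseteq> {..<3}" and ls: "y = word r ls" "set ls \<subseteq> {..<3}"
      using xy by (auto simp: word_group_def)
    \<comment> \<open>\<open>h\<close> is \<open>y\<close> times the inverse of \<open>x\<close>,
      and \<open>h'\<close> is the inverse of \<open>h\<close>.\<close>
    define h where "h = word r (ls @ rev ks)"
    define h' where "h' = word r (ks @ rev ls)"
    have "h \<circ> h' = word r ls \<circ> (word r (rev ks) \<circ> word r ks) \<circ> word r (rev ls)"
      "h' \<circ> h = word r ks \<circ> (word r (rev ls) \<circ> word r ls) \<circ> word r (rev ks)"
      by (simp_all add: h_def h'_def word_append o_assoc)
    then have inv: "h \<circ> h' = id" "h' \<circ> h = id"
      using word_rev[OF ks(2)] word_rev'[OF ks(2)] word_rev[OF ls(2)] word_rev'[OF ls(2)] r2 by simp_all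
    have mem: "word r us \<circ> z \<in> word_group r" if us: "set us \<subseteq> {..<3}" "z \<in> word_group r" for us z
    proof -
      obtain zs where "z = word r zs" "set zs \<subseteq> {..<3}" using us by (auto simp: word_group_def)
      then have "word r us \<circ> z = word r (us @ zs)" "set (us @ zs) \<subseteq> {..<3}"
        using us by (auto simp: word_append)
      then show ?thesis unfolding word_group_def by blast
    qed
    have "bij_betw (\<lambda>z. h \<circ> z) (word_group r) (word_group r)"
    proof (rule bij_betw_byWitness[where f' = "\<lambda>z. h' \<circ> z"])
      show "\<forall>z\<in>word_group r. h' \<circ> (h \<circ> z) = z" "\<forall>z\<in>word_group r. h \<circ> (h' \<circ> z) = z"
        using inv by (simp_all add: o_assoc)
      show "(\<lambda>z. h \<circ> z) ` word_group r \<subseteq> word_group r" "(\<lambda>z. h' \<circ> z) ` word_group r \<subseteq> word_group r"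
        unfolding h_def h'_def using mem ks ls by auto
    qed
    moreover have "h \<circ> x = y"
      using word_rev[OF ks(2)] r2 unfolding h_def ks(1) ls(1) word_append by (simp add: o_assoc[symmetric])
    moreover have "cayley r (h \<circ> z) = (\<lambda>z. h \<circ> z) ` cayley r z" for z
      by (simp add: cayley_def image_image o_assoc)
    ultimately show ?thesis by blast
  qed
qed

lemma word_group_ne: "word_group r \<noteq> {}"
proof -
  have "word r [] \<in> word_group r" unfolding word_group_def by (rule imageI) simp
  then show ?thesis by blast
qed

lemma card_gt: "r < card (word_group r)"
proof (rule core_large)
  show "core (cayley r) (word_group r)"
    unfolding core_def using word_group_ne cub nbr by (auto simp: Int_absorb2)
qed simp

end

lemma large_poles:
  assumes "3 \<le> d" "d + 2 \<le> L"
  shows "\<exists>(W :: (nat list \<Rightarrow> nat list) set) M \<pi>. pole W M \<pi> d L \<and> n \<le> card W"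
proof -
  \<comment> \<open>The part without \<open>n\<close> meets the demands of
    \<open>pole_exists\<close>; the summand \<open>n\<close> makes the group, and with it the pole,
    large.\<close>
  define r where "r = L + 4 * d + 17 + n"
  interpret cayley_graph r by unfold_locales (simp add: r_def)
  obtain W :: "(nat list \<Rightarrow> nat list) set" and M \<pi>
    where "pole W M \<pi> d L" "card W + d = card (word_group r) + 2"
    using pole_exists[of d L] assms word_group_ne unfolding r_def by auto
  then show ?thesis using card_gt r_def by (intro exI[of _ W] exI[of _ M] exI[of _ \<pi>]) auto
qed

lemma bit_pair_add_self: "(a :: bit \<times> bit) + a = 0"
  by (cases a) (simp add: zero_prod_def)

text \<open>Every edge enters the sum twice, and the group has exponent 2.\<close>

lemma (in sgraph) symmetric_sum:
  fixes f :: "'a \<Rightarrow> 'a \<Rightarrow> bit \<times> bit"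
  assumes "\<And>x y. x \<in> V \<Longrightarrow> y \<in> N x \<Longrightarrow> f x y = f y x"
  shows "(\<Sum>x\<in>V. \<Sum>y\<in>N x. f x y) = 0"
proof -
  have "(\<Sum>x\<in>A. \<Sum>y\<in>N x \<inter> A. f x y) = 0" if "A \<subseteq> V" for A
    using finite_sub[OF that] that
  proof (induction A rule: finite_induct)
    case (insert a A)
    have a: "a \<in> V" "A \<subseteq> V" using insert.prems by auto
    have fN: "finite (N x)" if "x \<in> insert a A" for x using that insert.prems finN by blast
    have aN: "N a \<inter> insert a A = N a \<inter> A" using irr[OF a(1)] by auto
    have st: "(\<Sum>y\<in>N x \<inter> insert a A. f x y) = (\<Sum>y\<in>N x \<inter> A. f x y) + (if x \<in> N a then f a x else 0)"
      if x: "x \<in> A" for x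
    proof (cases "x \<in> N a")
      case True
      then have "a \<in> N x" using symN[OF a(1)] by blast
      then have "N x \<inter> insert a A = insert a (N x \<inter> A)" by auto
      then show ?thesis using True insert.hyps fN x assms[OF a(1) True] by simp
    next
      case False
      then have "a \<notin> N x" using symN x a by blast
      then have "N x \<inter> insert a A = N x \<inter> A" by auto
      then show ?thesis using False by simp
    qed
    have "(\<Sum>x\<in>insert a A. \<Sum>y\<in>N x \<inter> insert a A. f x y)
        = (\<Sum>y\<in>N a \<inter> A. f a y) + (\<Sum>x\<in>A. if x \<in> N a then f a x else 0)"
      using insert aN st a by (simp add: sum.distrib)
    also have "(\<Sum>x\<in>A. if x \<in> N a then f a x else 0) = (\<Sum>y\<in>N a \<inter> A. f a y)"
      using insert.hyps by (simp add: sum.inter_restrict[symmetric] Int_commute)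
    finally show ?case by (simp add: bit_pair_add_self)
  qed simp
  from this[OF subset_refl] show ?thesis
    using nbr by (simp add: Int_absorb2 cong: sum.cong)
qed

section \<open>Expanding vertices into poles\<close>

text \<open>The vertices in \<open>T\<close> are cubic; every \<open>b \<in> B\<close> is going to be replaced by a pole whose port \<open>i\<close> is
  joined to \<open>att b i\<close>.\<close>

locale skeleton = sgraph T NT for T :: "'t set" and NT +
  fixes B :: "'b set" and att :: "'b \<Rightarrow> nat \<Rightarrow> 't" and d g :: nat
  assumes finB: "finite B"
    and att_T: "b \<in> B \<Longrightarrow> i < d \<Longrightarrow> att b i \<in> T"
    and deg3: "t \<in> T \<Longrightarrow> card (NT t) + card {(b, i). b \<in> B \<and> i < d \<and> att b i = t} = 3"
    and sk_core: "Z \<subseteq> T \<Longrightarrow> core NT Z \<Longrightarrow>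
      \<exists>b\<in>B. \<exists>I\<subseteq>{..<d}. inj_on (att b) I \<and> att b ` I \<subseteq> Z \<and> g \<le> card I"
    and sk_cut: "A \<subseteq> T \<Longrightarrow> S \<subseteq> B \<Longrightarrow>
      card (cut NT A) + card {(b, i). b \<in> B \<and> i < d \<and> (b \<in> S) \<noteq> (att b i \<in> A)} \<le> 4 \<Longrightarrow>
      S = {} \<or> S = B"
    and sk_noflow: "(\<And>t t'. t \<in> T \<Longrightarrow> t' \<in> NT t \<Longrightarrow> F t t' = F t' t \<and> F t t' \<noteq> 0) \<Longrightarrow>
      (\<And>b i. b \<in> B \<Longrightarrow> i < d \<Longrightarrow> x b i \<noteq> (0 :: bit \<times> bit)) \<Longrightarrow>
      (\<And>t. t \<in> T \<Longrightarrow> (\<Sum>t'\<in>NT t. F t t') + (\<Sum>(b, i)\<in>{(b, i). b \<in> B \<and> i < d \<and> att b i = t}. x b i) = 0) \<Longrightarrow>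
      (\<And>b. b \<in> B \<Longrightarrow> (\<Sum>i<d. x b i) = 0) \<Longrightarrow> False"
    and sk_circuit: "\<exists>u. inj_on u {..<g} \<and> (\<forall>i<g. u i \<in> T \<and> u (Suc i mod g) \<in> NT (u i))"
    and g5: "5 \<le> g"

locale expansion = skeleton T NT B att d g + W: pole W M \<pi> d L
  for T :: "'t set" and NT and B :: "'b set" and att d g and W :: "'w set" and M \<pi> L +
  assumes gL: "g \<le> L"
begin

definition XV :: "('t + 'b \<times> 'w) set" where
  "XV = Inl ` T \<union> Inr ` (B \<times> W)"

fun XN :: "'t + 'b \<times> 'w \<Rightarrow> ('t + 'b \<times> 'w) set" where
  "XN (Inl t) = Inl ` NT t \<union> (\<lambda>(b, i). Inr (b, \<pi> i)) ` {(b, i). b \<in> B \<and> i < d \<and> att b i = t}"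
| "XN (Inr (b, w)) = (\<lambda>w'. Inr (b, w')) ` M w \<union> (\<lambda>i. Inl (att b i)) ` {i. i < d \<and> \<pi> i = w}"

lemma finite_ports: "finite {(b, i). b \<in> B \<and> i < d \<and> P b i}"
  by (rule finite_subset[OF _ finite_cartesian_product[OF finB finite_lessThan[of d]]]) auto

lemma port_at: "{i. i < d \<and> \<pi> i = \<pi> j} = {j}" if "j < d"
  using that W.port_inj by (auto simp: inj_on_def)

lemma card_port_at: "card {i. i < d \<and> \<pi> i = w} = of_bool (w \<in> \<pi> ` {..<d})"
proof (cases "w \<in> \<pi> ` {..<d}")
  case True
  then obtain j where "j < d" "w = \<pi> j" by auto
  then show ?thesis using port_at[of j] by simp
next
  case False
  then have "{i. i < d \<and> \<pi> i = w} = {}" by auto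
  then show ?thesis using False by simp
qed

sublocale X: cubic_sgraph XV XN
proof
  show "finite XV" using fin finB W.fin by (simp add: XV_def)
  show "XN x \<subseteq> XV" if "x \<in> XV" for x
    using that att_T W.port_W
    by (cases x rule: XN.cases) (auto simp: XV_def dest: subsetD[OF nbr] subsetD[OF W.nbr])
  show "x \<notin> XN x" if "x \<in> XV" for x
    using that irr W.irr by (cases x rule: XN.cases) (auto simp: XV_def)
  show "x \<in> XN y" if "x \<in> XV" "y \<in> XN x" for x y
    using that symN W.symN by (cases x rule: XN.cases) (auto simp: XV_def)
  show "card (XN x) = 3" if x: "x \<in> XV" for x
  proof (cases x rule: XN.cases)
    case (1 t)
    then have t: "t \<in> T" using x by (auto simp: XV_def)
    let ?P = "{(b, i). b \<in> B \<and> i < d \<and> att b i = t}"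
    have "inj_on (\<lambda>(b, i). Inr (b, \<pi> i) :: 't + 'b \<times> 'w) ?P"
      using W.port_inj by (auto simp: inj_on_def)
    then have "card ((\<lambda>(b, i). Inr (b, \<pi> i) :: 't + 'b \<times> 'w) ` ?P) = card ?P" by (rule card_image)
    moreover have "card (Inl ` NT t :: ('t + 'b \<times> 'w) set) = card (NT t)" by (simp add: card_image)
    ultimately show ?thesis
      unfolding 1 XN.simps using deg3[OF t] finN[OF t] finite_ports[of "\<lambda>b i. att b i = t"]
      by (subst card_Un_disjoint) auto
  next
    case (2 b w)
    then have w: "w \<in> W" "b \<in> B" using x by (auto simp: XV_def)
    have "card ((\<lambda>i. Inl (att b i) :: 't + 'b \<times> 'w) ` {i. i < d \<and> \<pi> i = w}) = of_bool (w \<in> \<pi> ` {..<d})"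
    proof (cases "w \<in> \<pi> ` {..<d}")
      case True
      then obtain j where "j < d" "w = \<pi> j" by auto
      then show ?thesis using port_at[of j] by simp
    next
      case False
      then have "{i. i < d \<and> \<pi> i = w} = {}" by auto
      then show ?thesis using False by simp
    qed
    moreover have "card ((\<lambda>w'. Inr (b, w') :: 't + 'b \<times> 'w) ` M w) = card (M w)"
      by (simp add: card_image inj_on_def)
    ultimately show ?thesis
      unfolding 2 XN.simps using W.deg[OF w(1)] W.finN[OF w(1)]
      by (subst card_Un_disjoint) auto
  qed
qed

text \<open>A nonempty trace of \<open>Z\<close> on a pole would contain a vertex that
  \<open>peel\<close> leaves with at most one neighbour in \<open>Z\<close>, even counting its port
  edge. So \<open>Z\<close> lies in \<open>T\<close>, where \<open>sk_core\<close> applies.\<close>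

lemma core_avoids_poles:
  assumes Z: "Z \<subseteq> XV" "core XN Z" and small: "\<And>b. b \<in> B \<Longrightarrow> card {w. Inr (b, w) \<in> Z} \<le> L"
  shows "\<exists>b\<in>B. \<exists>I\<subseteq>{..<d}. inj_on (att b) I \<and> (\<lambda>i. Inl (att b i)) ` I \<subseteq> Z \<and> g \<le> card I"
proof -
  have fZ: "finite Z" using Z X.finite_sub by blast
  have no_Inr: "Inr (b, w) \<notin> Z" for b w
  proof
    assume bw: "Inr (b, w) \<in> Z"
    define Y where "Y = {w. Inr (b, w) \<in> Z}"
    have Y: "Y \<subseteq> W" "b \<in> B" "Y \<noteq> {}" using Z bw by (auto simp: Y_def XV_def)
    then obtain z where z: "z \<in> Y" "card (M z \<inter> Y) + of_bool (z \<in> \<pi> ` {..<d}) \<le> 1"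
      using W.peel small[of b] Y_def by blast
    have fM: "finite (M z)" using z Y W.finN by blast
    have "XN (Inr (b, z)) \<inter> Z \<subseteq> (\<lambda>w'. Inr (b, w')) ` (M z \<inter> Y) \<union> (\<lambda>i. Inl (att b i)) ` {i. i < d \<and> \<pi> i = z}"
      by (auto simp: Y_def)
    then have "card (XN (Inr (b, z)) \<inter> Z)
        \<le> card ((\<lambda>w'. Inr (b, w')) ` (M z \<inter> Y) \<union> (\<lambda>i. Inl (att b i) :: 't + 'b \<times> 'w) ` {i. i < d \<and> \<pi> i = z})"
      using fM by (intro card_mono) auto
    also have "\<dots> \<le> card ((\<lambda>w'. Inr (b, w') :: 't + 'b \<times> 'w) ` (M z \<inter> Y)) + card ((\<lambda>i. Inl (att b i) :: 't + 'b \<times> 'w) ` {i. i < d \<and> \<pi> i = z})"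
      by (rule card_Un_le)
    also have "\<dots> \<le> card (M z \<inter> Y) + card {i. i < d \<and> \<pi> i = z}"
      using fM by (intro add_mono card_image_le) auto
    also have "\<dots> \<le> 1" using z by (simp add: card_port_at)
    finally have "card (XN (Inr (b, z)) \<inter> Z) \<le> 1" .
    moreover have "2 \<le> card (XN (Inr (b, z)) \<inter> Z)"
      using Z(2) z unfolding core_def Y_def by blast
    ultimately show False by linarith
  qed
  define Y where "Y = {t. Inl t \<in> Z}"
  have ZY: "Z = Inl ` Y"
  proof (intro set_eqI iffI)
    fix p assume "p \<in> Z"
    then show "p \<in> Inl ` Y" using no_Inr Y_def by (cases p) auto
  qed (auto simp: Y_def)
  have YT: "Y \<subseteq> T" using Z by (auto simp: Y_def XV_def)
  have "2 \<le> card (NT t \<inter> Y)" if t: "t \<in> Y" for t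
  proof -
    have "XN (Inl t) \<inter> Z = Inl ` (NT t \<inter> Y)" unfolding ZY by auto
    then have "card (XN (Inl t) \<inter> Z) = card (NT t \<inter> Y)" by (simp add: card_image)
    then show ?thesis using Z(2) t unfolding core_def ZY by auto
  qed
  moreover have "Y \<noteq> {}" using Z(2) unfolding core_def ZY by auto
  ultimately have "core NT Y" unfolding core_def by blast
  then obtain b I where "b \<in> B" "I \<subseteq> {..<d}" "inj_on (att b) I" "att b ` I \<subseteq> Y" "g \<le> card I"
    using sk_core[OF YT] by blast
  then show ?thesis unfolding ZY by (intro bexI[of _ b] exI[of _ I]) auto
qed

lemma core_card_X:
  assumes "Z \<subseteq> XV" "core XN Z"
  shows "g \<le> card Z"
proof (rule ccontr)
  assume neg: "\<not> g \<le> card Z"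
  have fZ: "finite Z" using assms X.finite_sub by blast
  have "card {w. Inr (b, w) \<in> Z} \<le> L" for b
  proof -
    have "card {w. Inr (b, w) \<in> Z} \<le> card Z"
      using fZ by (intro card_inj_on_le[where f = "\<lambda>w. Inr (b, w)"]) (auto simp: inj_on_def)
    then show ?thesis using neg gL by linarith
  qed
  then obtain b I where I: "inj_on (att b) I" "(\<lambda>i. Inl (att b i)) ` I \<subseteq> Z" "g \<le> card I"
    using core_avoids_poles[OF assms] by blast
  have "card I \<le> card Z"
    using I fZ by (intro card_inj_on_le[where f = "\<lambda>i. Inl (att b i)"]) (auto simp: inj_on_def)
  then show False using I neg by linarith
qed

section \<open>Cuts of the expanded graph\<close>

definition part :: "('t + 'b \<times> 'w) set \<Rightarrow> 'b \<Rightarrow> 'w set" where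
  "part A b = {w \<in> W. Inr (b, w) \<in> A}"

definition tpart :: "('t + 'b \<times> 'w) set \<Rightarrow> 't set" where
  "tpart A = {t \<in> T. Inl t \<in> A}"

lemma cut_lower:
  assumes A: "A \<subseteq> XV"
  shows "card (cut NT (tpart A)) + ((\<Sum>b\<in>B. card (cut M (part A b)))
      + card {(b, i). b \<in> B \<and> i < d \<and> (\<pi> i \<in> part A b) \<noteq> (att b i \<in> tpart A)}) \<le> card (cut XN A)"
proof -
  let ?E = "{(b, i). b \<in> B \<and> i < d \<and> (\<pi> i \<in> part A b) \<noteq> (att b i \<in> tpart A)}"
  let ?S = "SIGMA b:B. cut M (part A b)"
  define h1 :: "'t \<times> 't \<Rightarrow> ('t + 'b \<times> 'w) \<times> ('t + 'b \<times> 'w)" where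
    "h1 = map_prod Inl Inl"
  define h2 :: "'b \<times> 'w \<times> 'w \<Rightarrow> ('t + 'b \<times> 'w) \<times> ('t + 'b \<times> 'w)" where
    "h2 = (\<lambda>(b, w, w'). (Inr (b, w), Inr (b, w')))"
  define h3 :: "'b \<times> nat \<Rightarrow> ('t + 'b \<times> 'w) \<times> ('t + 'b \<times> 'w)" where
    "h3 = (\<lambda>(b, i). if \<pi> i \<in> part A b then (Inr (b, \<pi> i), Inl (att b i)) else (Inl (att b i), Inr (b, \<pi> i)))"
  have fc: "finite (cut NT (tpart A))" "\<And>b. finite (cut M (part A b))"
    using finite_cut[of "tpart A"] W.finite_cut by (auto simp: tpart_def part_def)
  have fS: "finite ?S" using finB fc by auto
  have fE: "finite ?E" using finite_ports .
  have i1: "inj_on h1 (cut NT (tpart A))" by (auto simp: h1_def inj_on_def)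
  have i2: "inj_on h2 ?S" by (auto simp: h2_def inj_on_def)
  have i3: "inj_on h3 ?E" using W.port_inj by (auto simp: h3_def inj_on_def split: if_splits)
  have s1: "h1 ` cut NT (tpart A) \<subseteq> cut XN A"
    using nbr by (fastforce simp: h1_def cut_def tpart_def)
  have s2: "h2 ` ?S \<subseteq> cut XN A"
    using W.nbr by (fastforce simp: h2_def cut_def part_def)
  have s3: "h3 ` ?E \<subseteq> cut XN A"
    using att_T W.port_W by (auto simp: h3_def cut_def part_def tpart_def)
  have dis: "h1 ` cut NT (tpart A) \<inter> (h2 ` ?S \<union> h3 ` ?E) = {}" "h2 ` ?S \<inter> h3 ` ?E = {}"
    by (auto simp: h1_def h2_def h3_def split: if_splits)
  have "card (h1 ` cut NT (tpart A) \<union> (h2 ` ?S \<union> h3 ` ?E))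
      = card (cut NT (tpart A)) + (card ?S + card ?E)"
    using dis fc fS fE i1 i2 i3 by (simp add: card_Un_disjoint card_image)
  moreover have "card ?S = (\<Sum>b\<in>B. card (cut M (part A b)))"
    using finB fc by (intro card_SigmaI) auto
  moreover have "card (h1 ` cut NT (tpart A) \<union> (h2 ` ?S \<union> h3 ` ?E)) \<le> card (cut XN A)"
    using s1 s2 s3 X.finite_cut[OF A] by (intro card_mono) auto
  ultimately show ?thesis by linarith
qed

text \<open>The poles lying mainly in \<open>A\<close>, measured by the bound of
  \<open>small_side\<close>.\<close>

definition inside :: "('t + 'b \<times> 'w) set \<Rightarrow> 'b set" where
  "inside A = {b \<in> B. \<not> card (part A b) \<le> d + 2}"

text \<open>Moving the small side of every pole across the cut does not enlarge the cut, because a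
  small set of a pole has at least twice as many boundary edges as ports.\<close>

lemma skeleton_cut_le:
  assumes A: "A \<subseteq> XV" "card (cut XN A) \<le> 4"
  shows "card (cut NT (tpart A))
      + card {(b, i). b \<in> B \<and> i < d \<and> (b \<in> inside A) \<noteq> (att b i \<in> tpart A)} \<le> 4"
    and "b \<in> inside A \<Longrightarrow> card (W - part A b) \<le> d + 2"
proof -
  have pW: "part A b \<subseteq> W" for b by (auto simp: part_def)
  have c4: "card (cut M (part A b)) \<le> 4" if b: "b \<in> B" for b
  proof -
    have "card (cut M (part A b)) \<le> (\<Sum>b\<in>B. card (cut M (part A b)))"
      using finB b by (intro member_le_sum) auto
    then show ?thesis using cut_lower[OF A(1)] A(2) by linarith
  qed
  have sm: "card (W - part A b) \<le> d + 2" if "b \<in> inside A" for b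
    using W.small_side[OF pW c4] that by (auto simp: inside_def)
  then show "b \<in> inside A \<Longrightarrow> card (W - part A b) \<le> d + 2" .
  \<comment> \<open>The ports on the small side of their pole. Only their edges can start to cross
    when the pole is moved to its large side, and \<open>port_cut\<close> pays for them.\<close>
  let ?Q = "SIGMA b:B. {i. i < d \<and> (\<pi> i \<in> part A b) \<noteq> (b \<in> inside A)}"
  let ?E = "{(b, i). b \<in> B \<and> i < d \<and> (\<pi> i \<in> part A b) \<noteq> (att b i \<in> tpart A)}"
  have "card {i. i < d \<and> (\<pi> i \<in> part A b) \<noteq> (b \<in> inside A)} \<le> card (cut M (part A b))"
    if b: "b \<in> B" for b
  proof (cases "b \<in> inside A")
    case True
    have "{i. i < d \<and> (\<pi> i \<in> part A b) \<noteq> (b \<in> inside A)} = {i. i < d \<and> \<pi> i \<in> W - part A b}"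
      using True W.port_W by auto
    then show ?thesis
      using W.port_cut[of "W - part A b"] sm[OF True] W.dL W.cut_compl[OF pW] by simp
  next
    case False
    then have "card (part A b) \<le> L" using b W.dL by (simp add: inside_def)
    then show ?thesis using False W.port_cut[OF pW] by fastforce
  qed
  then have "card ?Q \<le> (\<Sum>b\<in>B. card (cut M (part A b)))"
    using finB by (subst card_SigmaI) (auto intro: sum_mono)
  moreover have "card {(b, i). b \<in> B \<and> i < d \<and> (b \<in> inside A) \<noteq> (att b i \<in> tpart A)} \<le> card ?E + card ?Q"
  proof -
    have "card {(b, i). b \<in> B \<and> i < d \<and> (b \<in> inside A) \<noteq> (att b i \<in> tpart A)} \<le> card (?E \<union> ?Q)"
      using finite_ports finB by (intro card_mono finite_UnI finite_SigmaI) auto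
    then show ?thesis using card_Un_le[of ?E ?Q] by linarith
  qed
  ultimately show "card (cut NT (tpart A))
      + card {(b, i). b \<in> B \<and> i < d \<and> (b \<in> inside A) \<noteq> (att b i \<in> tpart A)} \<le> 4"
    using cut_lower[OF A(1)] A(2) by linarith
qed

text \<open>A core in \<open>A\<close> has a small trace on each pole, so it contains
  \<open>g\<close> vertices attached to a single pole \<open>b\<close>. As \<open>b\<close> is not
  inside, these \<open>g \<ge> 5\<close> edges all cross the skeleton cut.\<close>

lemma outside_acyclic:
  assumes A: "A \<subseteq> XV" "card (cut XN A) \<le> 4" "inside A = {}"
  shows "\<not> cyclic XN A"
proof
  assume "cyclic XN A"
  then obtain Z where Z: "Z \<subseteq> A" "core XN Z" unfolding cyclic_def by blast
  have "card {w. Inr (b, w) \<in> Z} \<le> L" if b: "b \<in> B" for b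
  proof -
    have "{w. Inr (b, w) \<in> Z} \<subseteq> part A b" using Z A by (auto simp: part_def XV_def)
    then have "card {w. Inr (b, w) \<in> Z} \<le> card (part A b)"
      using W.fin by (intro card_mono) (auto simp: part_def)
    also have "\<dots> \<le> d + 2" using A(3) b by (auto simp: inside_def)
    finally show ?thesis using W.dL by linarith
  qed
  then obtain b I where I: "b \<in> B" "I \<subseteq> {..<d}" "(\<lambda>i. Inl (att b i)) ` I \<subseteq> Z" "g \<le> card I"
    using core_avoids_poles[of Z] Z A by blast
  have "card I \<le> card {(b, i). b \<in> B \<and> i < d \<and> (b \<in> inside A) \<noteq> (att b i \<in> tpart A)}"
  proof (rule card_inj_on_le[where f = "\<lambda>i. (b, i)"])
    show "(\<lambda>i. (b, i)) ` I \<subseteq> {(b, i). b \<in> B \<and> i < d \<and> (b \<in> inside A) \<noteq> (att b i \<in> tpart A)}"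
      using I Z att_T A(3) by (auto simp: tpart_def)
    show "finite {(b, i). b \<in> B \<and> i < d \<and> (b \<in> inside A) \<noteq> (att b i \<in> tpart A)}"
      by (rule finite_ports)
  qed (simp add: inj_on_def)
  then show False using skeleton_cut_le(1)[OF A(1,2)] I g5 by linarith
qed

text \<open>Sum conservation over the pole: its inner edges cancel and the port edges
  remain.\<close>

lemma flow_sum_X:
  assumes "nz_flow XV XN f" "b \<in> B"
  shows "(\<Sum>i<d. f (Inr (b, \<pi> i)) (Inl (att b i))) = 0"
proof -
  have mem: "Inr (b, w) \<in> XV" if "w \<in> W" for w using that assms by (auto simp: XV_def)
  have z: "(\<Sum>w'\<in>M w. f (Inr (b, w)) (Inr (b, w'))) + (\<Sum>i | i < d \<and> \<pi> i = w. f (Inr (b, w)) (Inl (att b i))) = 0"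
    if w: "w \<in> W" for w
  proof -
    have "inj_on (\<lambda>i. Inl (att b i) :: 't + 'b \<times> 'w) {i. i < d \<and> \<pi> i = w}"
      using W.port_inj by (auto simp: inj_on_def)
    then have "(\<Sum>y\<in>XN (Inr (b, w)). f (Inr (b, w)) y) =
        (\<Sum>w'\<in>M w. f (Inr (b, w)) (Inr (b, w'))) + (\<Sum>i | i < d \<and> \<pi> i = w. f (Inr (b, w)) (Inl (att b i)))"
      unfolding XN.simps using W.finN[OF w]
      by (subst sum.union_disjoint) (auto simp: sum.reindex inj_on_def)
    moreover have "(\<Sum>y\<in>XN (Inr (b, w)). f (Inr (b, w)) y) = 0"
      using assms(1) mem[OF w] unfolding nz_flow_def by blast
    ultimately show ?thesis by simp
  qed
  have "(\<Sum>w\<in>W. \<Sum>w'\<in>M w. f (Inr (b, w)) (Inr (b, w'))) = 0"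
  proof (rule W.symmetric_sum)
    fix w w' assume "w \<in> W" "w' \<in> M w"
    then have "Inr (b, w) \<in> XV" "Inr (b, w') \<in> XN (Inr (b, w))" using mem by auto
    then show "f (Inr (b, w)) (Inr (b, w')) = f (Inr (b, w')) (Inr (b, w))"
      using assms(1) unfolding nz_flow_def by blast
  qed
  moreover have "(\<Sum>w\<in>W. \<Sum>i | i < d \<and> \<pi> i = w. f (Inr (b, w)) (Inl (att b i)))
      = (\<Sum>i<d. f (Inr (b, \<pi> i)) (Inl (att b i)))"
  proof -
    have "(\<Sum>w\<in>W. \<Sum>i | i < d \<and> \<pi> i = w. f (Inr (b, w)) (Inl (att b i)))
        = (\<Sum>w\<in>W. \<Sum>i | i \<in> {..<d} \<and> \<pi> i = w. f (Inr (b, \<pi> i)) (Inl (att b i)))"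
      by (intro sum.cong) auto
    also have "\<dots> = (\<Sum>i<d. f (Inr (b, \<pi> i)) (Inl (att b i)))"
      using W.fin W.port_W by (intro sum.group) auto
    finally show ?thesis .
  qed
  moreover have "(\<Sum>w\<in>W. (\<Sum>w'\<in>M w. f (Inr (b, w)) (Inr (b, w'))) + (\<Sum>i | i < d \<and> \<pi> i = w. f (Inr (b, w)) (Inl (att b i)))) = 0"
    using z by simp
  ultimately show ?thesis by (simp add: sum.distrib)
qed

sublocale X: snark_sgraph XV XN g
proof
  obtain u where u: "inj_on u {..<g}" "\<And>i. i < g \<Longrightarrow> u i \<in> T \<and> u (Suc i mod g) \<in> NT (u i)"
    using sk_circuit by blast
  show "XV \<noteq> {}" using u(2)[of 0] g5 by (auto simp: XV_def)
  show "\<exists>u. inj_on u {..<g} \<and> (\<forall>i<g. u i \<in> XV \<and> u (Suc i mod g) \<in> XN (u i))"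
    using u by (intro exI[of _ "\<lambda>i. Inl (u i)"]) (auto simp: inj_on_def XV_def)
  show "3 \<le> g" using g5 by simp
  show "g \<le> card Z" if "Z \<subseteq> XV" "core XN Z" for Z using core_card_X that .
  show "\<not> cyclic XN A \<or> \<not> cyclic XN (XV - A)" if A: "A \<subseteq> XV" "card (cut XN A) \<le> 4" for A
  proof -
    have "inside A = {} \<or> inside A = B"
      using sk_cut[of "tpart A" "inside A"] skeleton_cut_le(1)[OF A] by (auto simp: tpart_def inside_def)
    then show ?thesis
    proof
      assume "inside A = {}"
      then show ?thesis using outside_acyclic A by blast
    next
      assume B: "inside A = B"
      have "part (XV - A) b = W - part A b" if "b \<in> B" for b
        using that by (auto simp: part_def XV_def)
      then have "inside (XV - A) = {}" using skeleton_cut_le(2)[OF A] B by (auto simp: inside_def)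
      then show ?thesis using outside_acyclic[of "XV - A"] X.cut_compl[OF A(1)] A by auto
    qed
  qed
  show "\<not> nz_flow XV XN f" for f
  proof
    assume f: "nz_flow XV XN f"
    have fs: "f x y = f y x" "f x y \<noteq> 0" if "x \<in> XV" "y \<in> XN x" for x y
      using f that unfolding nz_flow_def by blast+
    show False
    proof (rule sk_noflow[of "\<lambda>t t'. f (Inl t) (Inl t')" "\<lambda>b i. f (Inr (b, \<pi> i)) (Inl (att b i))"])
      show "f (Inl t) (Inl t') = f (Inl t') (Inl t) \<and> f (Inl t) (Inl t') \<noteq> 0" if "t \<in> T" "t' \<in> NT t" for t t'
        using fs[of "Inl t" "Inl t'"] that by (auto simp: XV_def)
      show "f (Inr (b, \<pi> i)) (Inl (att b i)) \<noteq> 0" if "b \<in> B" "i < d" for b i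
        using fs(2)[of "Inr (b, \<pi> i)" "Inl (att b i)"] that W.port_W by (auto simp: XV_def)
      show "(\<Sum>i<d. f (Inr (b, \<pi> i)) (Inl (att b i))) = 0" if "b \<in> B" for b
        using flow_sum_X[OF f that] .
      show "(\<Sum>t'\<in>NT t. f (Inl t) (Inl t'))
          + (\<Sum>(b, i)\<in>{(b, i). b \<in> B \<and> i < d \<and> att b i = t}. f (Inr (b, \<pi> i)) (Inl (att b i))) = 0"
        if t: "t \<in> T" for t
      proof -
        let ?P = "{(b, i). b \<in> B \<and> i < d \<and> att b i = t}"
        have tX: "Inl t \<in> XV" using t by (auto simp: XV_def)
        have inj: "inj_on (\<lambda>(b, i). Inr (b, \<pi> i) :: 't + 'b \<times> 'w) ?P"
          using W.port_inj by (auto simp: inj_on_def)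
        have "(\<Sum>y\<in>XN (Inl t). f (Inl t) y) = (\<Sum>t'\<in>NT t. f (Inl t) (Inl t'))
            + (\<Sum>y\<in>(\<lambda>(b, i). Inr (b, \<pi> i)) ` ?P. f (Inl t) y)"
          unfolding XN.simps using finN[OF t] finite_ports[of "\<lambda>b i. att b i = t"]
          by (subst sum.union_disjoint) (auto simp: sum.reindex inj_on_def)
        also have "(\<Sum>y\<in>(\<lambda>(b, i). Inr (b, \<pi> i)) ` ?P. f (Inl t) y)
            = (\<Sum>(b, i)\<in>?P. f (Inr (b, \<pi> i)) (Inl (att b i)))"
          unfolding sum.reindex[OF inj]
        proof (rule sum.cong)
          fix p assume p: "p \<in> ?P"
          obtain b i where bi: "p = (b, i)" by (cases p)
          have "Inr (b, \<pi> i) \<in> XN (Inl t)" using p bi by auto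
          then show "((\<lambda>y. f (Inl t) y) \<circ> (\<lambda>(b, i). Inr (b, \<pi> i))) p
              = (case p of (b, i) \<Rightarrow> f (Inr (b, \<pi> i)) (Inl (att b i)))"
            using fs(1)[OF tX] p bi by auto
        qed simp
        finally show ?thesis using f tX unfolding nz_flow_def by auto
      qed
    qed
  qed
qed

lemma card_XV: "b \<in> B \<Longrightarrow> card W \<le> card XV"
  using X.fin by (intro card_inj_on_le[where f = "\<lambda>w. Inr (b, w)"]) (auto simp: inj_on_def XV_def)

end

section \<open>The skeleton\<close>

text \<open>Boolean coordinates turn flow conditions over the Klein group into propositional
  formulas that \<open>sat\<close> decides.\<close>

definition hi :: "bit \<times> bit \<Rightarrow> bool" where "hi a \<longleftrightarrow> fst a = 1"
definition lo :: "bit \<times> bit \<Rightarrow> bool" where "lo a \<longleftrightarrow> snd a = 1"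

lemma pair_sum4: "a + b + c + d = 0 \<longleftrightarrow> ((hi a \<noteq> hi b) \<noteq> hi c) = hi d \<and> ((lo a \<noteq> lo b) \<noteq> lo c) = lo d"
proof -
  have "p + q + r + s = 0 \<longleftrightarrow> (((p = 1) \<noteq> (q = 1)) \<noteq> (r = 1)) = (s = 1)" for p q r s :: bit
    by (cases p; cases q; cases r; cases s) auto
  then show ?thesis unfolding hi_def lo_def prod_eq_iff by simp
qed

lemma pair_sum3: "a + b + c = 0 \<longleftrightarrow> (hi a \<noteq> hi b) = hi c \<and> (lo a \<noteq> lo b) = lo c"
  using pair_sum4[of a b c 0] by (simp add: hi_def lo_def)

lemma pair_sum2: "a + b = 0 \<longleftrightarrow> hi a = hi b \<and> lo a = lo b"
  using pair_sum3[of a b 0] by (auto simp: hi_def lo_def)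

lemma pair_nonzero: "a \<noteq> 0 \<longleftrightarrow> hi a \<or> lo a"
  using pair_sum2[of a 0] by (simp add: hi_def lo_def)

text \<open>The Petersen graph has no nowhere-zero flow; here it appears with three independent
  vertices, with the ends of two edges at distance two, and with a hexagon singled out.\<close>

lemma petersen_independent:
  assumes "z0 \<noteq> (0 :: bit \<times> bit)" "z1 \<noteq> 0" "z2 \<noteq> 0" "x0 \<noteq> 0" "x1 \<noteq> 0" "x2 \<noteq> 0"
    "p00 \<noteq> 0" "p01 \<noteq> 0" "p02 \<noteq> 0" "p10 \<noteq> 0" "p11 \<noteq> 0" "p12 \<noteq> 0" "p20 \<noteq> 0" "p21 \<noteq> 0" "p22 \<noteq> 0"
    and "z0 + z1 + z2 = 0" "z0 + x0 + p00 = 0" "z1 + x1 + p10 = 0" "z2 + x2 + p20 = 0"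
    "x0 + p12 + p21 = 0" "x1 + p01 + p22 = 0" "x2 + p02 + p11 = 0"
    "p00 + p01 + p02 + s0 = 0" "p10 + p11 + p12 + s1 = 0" "p20 + p21 + p22 + s2 = 0"
  shows "s0 + s1 + s2 = 0" "s0 \<noteq> 0 \<or> s1 \<noteq> 0"
  using assms unfolding pair_sum4 unfolding pair_sum3 pair_nonzero by sat+

text \<open>\<open>a\<close>, \<open>b\<close> are the values missing at the ends of one removed
  edge, \<open>c\<close>, \<open>d\<close> at those of the other. If \<open>a = b\<close> and
  \<open>c = d\<close> were nonzero, putting them on the two edges would give a flow on the Petersen
  graph.\<close>

lemma petersen_two_edges:
  assumes "m \<noteq> (0 :: bit \<times> bit)" "l00 \<noteq> 0" "l01 \<noteq> 0" "l10 \<noteq> 0" "l11 \<noteq> 0" "a3 \<noteq> 0" "a4 \<noteq> 0" "b3 \<noteq> 0" "b4 \<noteq> 0"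
    "c3 \<noteq> 0" "c4 \<noteq> 0" "d3 \<noteq> 0" "d4 \<noteq> 0"
    and "m + l00 + l01 = 0" "m + l10 + l11 = 0" "l00 + a3 + d3 = 0" "l01 + b3 + c3 = 0"
    "l10 + a4 + c4 = 0" "l11 + b4 + d4 = 0"
    "a3 + a4 + a = 0" "b3 + b4 + b = 0" "c3 + c4 + c = 0" "d3 + d4 + d = 0"
  shows "a + b + c + d = 0" "\<not> (a + b = 0 \<and> c + d = 0 \<and> a \<noteq> 0 \<and> c \<noteq> 0)"
  using assms unfolding pair_sum4 unfolding pair_sum3 unfolding pair_sum2 pair_nonzero by sat+

lemma petersen_hexagon:
  assumes "f0 \<noteq> (0 :: bit \<times> bit)" "f1 \<noteq> 0" "f2 \<noteq> 0" "f3 \<noteq> 0" "f4 \<noteq> 0" "f5 \<noteq> 0"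
    "x0 \<noteq> 0" "x1 \<noteq> 0" "x2 \<noteq> 0" "x3 \<noteq> 0" "x4 \<noteq> 0" "x5 \<noteq> 0" "t0 \<noteq> 0" "t1 \<noteq> 0" "t2 \<noteq> 0"
    and "f0 + f5 + x0 = 0" "f1 + f0 + x1 = 0" "f2 + f1 + x2 = 0" "f3 + f2 + x3 = 0" "f4 + f3 + x4 = 0"
    "f5 + f4 + x5 = 0" "t0 + x0 + x3 = 0" "t1 + x1 + x4 = 0" "t2 + x2 + x5 = 0" "t0 + t1 + t2 = 0"
  shows False
  using assms unfolding pair_sum3 pair_nonzero by sat

section \<open>Explicit description of the skeleton graph\<close>

datatype three = S0 | S1 | S2

lemma UNIV_three: "UNIV = {S0, S1, S2}"
  using three.exhaust by auto

instance three :: finite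
  by standard (simp add: UNIV_three)

fun nx :: "three \<Rightarrow> three" where "nx S0 = S1" | "nx S1 = S2" | "nx S2 = S0"

text \<open>Chinese remainder coordinates on the hexagon: \<open>hnext\<close> adds 1, and opposite
  vertices differ in the first component only, so the leaf \<open>TL s\<close> is joined to
  \<open>BT (False, s)\<close> and \<open>BT (True, s)\<close>.\<close>

type_synonym hexi = "bool \<times> three"

fun hnext :: "hexi \<Rightarrow> hexi" where "hnext (h, s) = (\<not> h, nx s)"
fun hprev :: "hexi \<Rightarrow> hexi" where "hprev (h, s) = (\<not> h, nx (nx s))"

lemma nx3 [simp]: "nx (nx (nx s)) = s"
  by (cases s) auto

lemma hprev_hnext [simp]: "hprev (hnext r) = r" "hnext (hprev r) = r"
  by (cases r; simp)+

text \<open>Edge \<open>r\<close> of the hexagon is replaced by a dipole, which is the Petersen graph with two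
  edges at distance two (tree vertices \<open>NP\<close>, \<open>NL\<close>) replaced in turn, for \<open>j\<close> in \<open>{False, True}\<close>,
  by the Petersen graph minus three independent vertices (tree vertices \<open>OZ\<close>, \<open>OX\<close>, \<open>OY\<close>).
  The expanded vertex \<open>BT r\<close> is a vertex of the hexagon, \<open>TZ\<close> and \<open>TL\<close> form the rest of the outer
  Petersen graph, and \<open>BI r j e\<close> is an end of edge \<open>j\<close> inside dipole \<open>r\<close>. A circuit of vertices \<open>CC\<close>
  is attached to every expanded vertex, of length \<open>g\<close> or \<open>g + 2\<close> so that all of them get \<open>g + 7\<close> ports.\<close>

datatype bv = BI hexi bool bool | BT hexi
datatype tv = OZ hexi bool | OX hexi bool three | OY hexi bool three
  | NP hexi bool | NL hexi bool bool | TZ | TL three | CC bv nat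

lemma UNIV_bv: "UNIV = (\<lambda>(r, j, e). BI r j e) ` UNIV \<union> range BT"
proof (intro set_eqI iffI UNIV_I)
  fix b show "b \<in> (\<lambda>(r, j, e). BI r j e) ` UNIV \<union> range BT" by (cases b) (auto simp: image_iff)
qed

instance bv :: finite
  by standard (subst UNIV_bv, simp)

lemma sum_bv: "(\<Sum>b\<in>UNIV. f b) = (\<Sum>r\<in>UNIV. (\<Sum>j\<in>UNIV. \<Sum>e\<in>UNIV. f (BI r j e)) + f (BT r))"
  for f :: "bv \<Rightarrow> nat"
proof -
  have "(\<Sum>b\<in>UNIV. f b) = (\<Sum>b\<in>(\<lambda>(r, j, e). BI r j e) ` UNIV. f b) + (\<Sum>b\<in>range BT. f b)"
    by (subst UNIV_bv, subst sum.union_disjoint) auto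
  also have "(\<Sum>b\<in>range BT. f b) = (\<Sum>r\<in>UNIV. f (BT r))"
    by (simp add: sum.reindex inj_on_def)
  also have "(\<Sum>b\<in>(\<lambda>(r, j, e). BI r j e) ` UNIV. f b) = (\<Sum>(r, j, e)\<in>UNIV. f (BI r j e))"
    by (subst sum.reindex) (auto simp: inj_on_def case_prod_beta)
  also have "\<dots> = (\<Sum>r\<in>UNIV. \<Sum>j\<in>UNIV. \<Sum>e\<in>UNIV. f (BI r j e))"
    by (simp add: UNIV_Times_UNIV[symmetric] sum.cartesian_product del: UNIV_Times_UNIV)
  finally show ?thesis by (simp add: sum.distrib)
qed

fun base :: "bv \<Rightarrow> nat" where "base (BI r j e) = 5" | "base (BT r) = 7"

definition circ :: "nat \<Rightarrow> bv \<Rightarrow> nat" where "circ g b = g + 7 - base b"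

fun side :: "bool \<Rightarrow> three" where "side e = (if e then S1 else S0)"

text \<open>Ports 0 to 2 of \<open>BI r j e\<close> are the edges at the deleted vertex it replaces,
  3 and 4 its edges in the second Petersen graph. Without the negation in port 3,
  \<open>BI r False l\<close>, \<open>NL r False l\<close>, \<open>BI r True l\<close>,
  \<open>NL r True l\<close> would form a 4-circuit, which the Petersen graph does not
  contain.\<close>

fun port :: "bv \<Rightarrow> nat \<Rightarrow> tv" where
  "port (BI r j e) i =
     (if i = 0 then OX r j (side e) else if i = 1 then OY r j (nx (side e))
      else if i = 2 then OY r j (nx (nx (side e)))
      else if i = 3 then NL r False (if j then \<not> e else e) else if i = 4 then NL r True e
      else CC (BI r j e) (i - 5))"
| "port (BT r) i =
     (if i = 0 then OX r False S2 else if i = 1 then OY r False S0 else if i = 2 then OY r False S1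
      else if i = 3 then OX (hprev r) True S2 else if i = 4 then OY (hprev r) True S0
      else if i = 5 then OY (hprev r) True S1 else if i = 6 then TL (snd r) else CC (BT r) (i - 7))"

fun tree_nbrs :: "nat \<Rightarrow> tv \<Rightarrow> tv set" where
  "tree_nbrs g (OZ r j) = {OX r j S0, OX r j S1, OX r j S2}"
| "tree_nbrs g (OX r j s) = {OZ r j, OY r j s}"
| "tree_nbrs g (OY r j s) = {OX r j s}"
| "tree_nbrs g (NP r h) = {NP r (\<not> h), NL r h False, NL r h True}"
| "tree_nbrs g (NL r h l) = {NP r h}"
| "tree_nbrs g TZ = {TL S0, TL S1, TL S2}"
| "tree_nbrs g (TL s) = {TZ}"
| "tree_nbrs g (CC b k) = {CC b (Suc k mod circ g b), CC b ((k + circ g b - 1) mod circ g b)}"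

definition tree_verts :: "nat \<Rightarrow> tv set" where
  "tree_verts g = {t. \<forall>b k. t = CC b k \<longrightarrow> k < circ g b}"

text \<open>The inverse of \<open>port\<close>, tabulated so that degrees and conservation laws at
  tree vertices follow by simplification.\<close>

fun ports_at :: "tv \<Rightarrow> (bv \<times> nat) set" where
  "ports_at (OX r j s) = {(case s of S0 \<Rightarrow> (BI r j False, 0) | S1 \<Rightarrow> (BI r j True, 0)
     | S2 \<Rightarrow> if j then (BT (hnext r), 3) else (BT r, 0))}"
| "ports_at (OY r j s) = (case s of
     S0 \<Rightarrow> {(BI r j True, 2), if j then (BT (hnext r), 4) else (BT r, 1)}
   | S1 \<Rightarrow> {(BI r j False, 1), if j then (BT (hnext r), 5) else (BT r, 2)}
   | S2 \<Rightarrow> {(BI r j False, 2), (BI r j True, 1)})"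
| "ports_at (NL r h l) = (if h then {(BI r False l, 4), (BI r True l, 4)} else {(BI r False l, 3), (BI r True (\<not> l), 3)})"
| "ports_at (TL s) = {(BT (False, s), 6), (BT (True, s), 6)}"
| "ports_at (CC b k) = {(b, base b + k)}"
| "ports_at t = {}"

lemma hnext_eq: "hprev r = r' \<longleftrightarrow> r = hnext r'"
  by (metis hprev_hnext)

lemma ports_at_eq:
  assumes "t \<in> tree_verts g"
  shows "{(b, i). b \<in> UNIV \<and> i < g + 7 \<and> port b i = t} = ports_at t"
proof -
  have "(b, i) \<in> ports_at t \<longleftrightarrow> i < g + 7 \<and> port b i = t" for b i
  proof (cases b)
    case (BI r j e)
    show ?thesis
      using assms unfolding BI
      by (cases t; cases e)
        (auto simp: tree_verts_def circ_def hnext_eq split: if_splits three.splits)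
  next
    case (BT r)
    show ?thesis
      using assms unfolding BT
      by (cases t; cases r)
        (auto simp: tree_verts_def circ_def hnext_eq split: if_splits three.splits)
  qed
  then show ?thesis by auto
qed

lemma card_ports_at: "card (tree_nbrs g t) + card (ports_at t) = 3" if "t \<in> tree_verts g" "g \<ge> 3"
proof (cases t)
  case (CC b k)
  then have k: "k < circ g b" using that by (auto simp: tree_verts_def)
  have c: "circ g b \<ge> 3" using that by (cases b) (auto simp: circ_def)
  have "Suc k mod circ g b \<noteq> (k + circ g b - 1) mod circ g b"
  proof (cases "k = 0")
    case True
    then show ?thesis using c by simp
  next
    case False
    then have "(k + circ g b - 1) mod circ g b = k - 1"
      using k by (simp add: mod_if)
    then show ?thesis using k c False by (cases "Suc k = circ g b") auto
  qed
  then show ?thesis using CC by simp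
qed (auto split: three.splits)

lemma finite_tree_verts: "finite (tree_verts g)"
proof -
  have "tree_verts g \<subseteq> range (case_prod OZ) \<union> range (\<lambda>(r, j, s). OX r j s) \<union> range (\<lambda>(r, j, s). OY r j s)
     \<union> range (case_prod NP) \<union> range (\<lambda>(r, h, l). NL r h l) \<union> {TZ} \<union> range TL \<union> (\<Union>b. CC b ` {..<circ g b})"
  proof
    fix t assume "t \<in> tree_verts g"
    then show "t \<in> range (case_prod OZ) \<union> range (\<lambda>(r, j, s). OX r j s) \<union> range (\<lambda>(r, j, s). OY r j s)
     \<union> range (case_prod NP) \<union> range (\<lambda>(r, h, l). NL r h l) \<union> {TZ} \<union> range TL \<union> (\<Union>b. CC b ` {..<circ g b})"
      by (cases t) (auto simp: tree_verts_def image_iff)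
  qed
  then show ?thesis by (rule finite_subset) auto
qed

lemma circ_pred_Suc: "k < c \<Longrightarrow> (Suc k mod c + c - 1) mod c = k"
  by (cases "Suc k = c") auto

lemma circ_Suc_pred: assumes "k < c" shows "Suc ((k + c - 1) mod c) mod c = k"
proof (cases "k = 0")
  case False
  then have "(k + c - 1) mod c = k - 1" using assms by (simp add: mod_if)
  then show ?thesis using assms False by simp
qed (use assms in auto)

lemma sgraph_tree: assumes "g \<ge> 5" shows "sgraph (tree_verts g) (tree_nbrs g)"
proof
  have c: "circ g b \<ge> 3" for b using assms by (cases b) (auto simp: circ_def)
  show "finite (tree_verts g)" by (rule finite_tree_verts)
  show "tree_nbrs g x \<subseteq> tree_verts g" if "x \<in> tree_verts g" for x
    using that c[THEN less_le_trans[rotated]] by (cases x) (auto simp: tree_verts_def)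
  show "x \<notin> tree_nbrs g x" if "x \<in> tree_verts g" for x
  proof (cases x)
    case (CC b k)
    then have k: "k < circ g b" using that by (auto simp: tree_verts_def)
    have "Suc k mod circ g b \<noteq> k" using k c[of b] by (cases "Suc k = circ g b") auto
    moreover have "(k + circ g b - 1) mod circ g b \<noteq> k"
      using circ_Suc_pred[OF k] \<open>Suc k mod circ g b \<noteq> k\<close> by metis
    ultimately show ?thesis using CC by auto
  qed auto
  show "x \<in> tree_nbrs g y" if "x \<in> tree_verts g" "y \<in> tree_nbrs g x" for x y
  proof (cases x)
    case (CC b k)
    then have k: "k < circ g b" using that by (auto simp: tree_verts_def)
    then show ?thesis using that CC circ_pred_Suc[OF k] circ_Suc_pred[OF k] by auto
  qed (use that in \<open>auto split: three.splits intro: three.exhaust\<close>)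
qed

lemma port_circ: "base b \<le> i \<Longrightarrow> port b i = CC b (i - base b)"
  by (cases b) auto

lemma base_le: "base b \<le> 7"
  by (cases b) auto

lemma circ_ge: "g \<le> circ g b"
  using base_le[of b] by (simp add: circ_def)

text \<open>Stripping leaves removes all trees, so a core meets some attached circuit. There each
  vertex needs both its neighbours, and the whole circuit lies in the core.\<close>

lemma tree_core:
  assumes g: "5 \<le> g" and Z: "Z \<subseteq> tree_verts g" "core (tree_nbrs g) Z"
  shows "\<exists>b\<in>UNIV. \<exists>I\<subseteq>{..<g + 7}. inj_on (port b) I \<and> port b ` I \<subseteq> Z \<and> g \<le> card I"
proof -
  have one: False if "t \<in> Z" "tree_nbrs g t \<inter> Z \<subseteq> {u}" for t u
  proof -
    have "card (tree_nbrs g t \<inter> Z) \<le> card {u}" using that by (intro card_mono) auto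
    then show False using Z(2) that unfolding core_def by fastforce
  qed
  have oy: "OY r j s \<notin> Z" for r j s using one[of "OY r j s" "OX r j s"] by auto
  have ox: "OX r j s \<notin> Z" for r j s using one[of "OX r j s" "OZ r j"] oy[of r j s] by auto
  \<comment> \<open>The intersection is empty here, so the singleton is arbitrary.\<close>
  have oz: "OZ r j \<notin> Z" for r j using one[of "OZ r j" undefined] ox[of r j] by auto
  have nl: "NL r h l \<notin> Z" for r h l using one[of "NL r h l" "NP r h"] by auto
  have np: "NP r h \<notin> Z" for r h using one[of "NP r h" "NP r (\<not> h)"] nl[of r h] by auto
  have tl: "TL s \<notin> Z" for s using one[of "TL s" TZ] by auto
  have tz: "TZ \<notin> Z" using one[of TZ undefined] tl by auto
  obtain t where "t \<in> Z" using Z(2) unfolding core_def by blast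
  then obtain b k where bk: "CC b k \<in> Z" using oy ox oz nl np tl tz by (cases t) auto
  have c: "circ g b > 0" using circ_ge[of g b] g by linarith
  have suc: "CC b (Suc i mod circ g b) \<in> Z" if "CC b i \<in> Z" for i
    using one[OF that, of "CC b ((i + circ g b - 1) mod circ g b)"] by fastforce
  have all: "CC b ((k + n) mod circ g b) \<in> Z" for n
  proof (induction n)
    case 0
    have "k < circ g b" using bk Z(1) by (auto simp: tree_verts_def)
    then show ?case using bk by simp
  next
    case (Suc n)
    then show ?case using suc[OF Suc] by (simp add: mod_Suc_eq)
  qed
  define I where "I = {base b..<g + 7}"
  have "port b i \<in> Z" if "i \<in> I" for i
  proof -
    have k: "k < circ g b" using bk Z(1) by (auto simp: tree_verts_def)
    have i: "i - base b < circ g b" using that by (auto simp: I_def circ_def)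
    \<comment> \<open>\<open>circ g b - k\<close> steps lead from \<open>k\<close> to position 0,
      and \<open>i - base b\<close> more to the wanted vertex.\<close>
    have "(k + (i - base b + (circ g b - k))) mod circ g b = i - base b"
      using k i by (simp add: mod_if)
    then show ?thesis using all[of "i - base b + (circ g b - k)"] port_circ[of b i] that I_def by simp
  qed
  moreover have "inj_on (port b) I" by (auto simp: inj_on_def I_def port_circ)
  moreover have "g \<le> card I" using circ_ge[of g b] by (simp add: I_def circ_def)
  ultimately show ?thesis by (intro bexI[of _ b] exI[of _ I]) (auto simp: I_def)
qed

section \<open>Small cuts of the skeleton\<close>

abbreviation neqb :: "bool \<Rightarrow> bool \<Rightarrow> nat" where "neqb p q \<equiv> of_bool (p \<noteq> q)"

text \<open>The size of a cut of the Petersen graph: each Boolean gives the side of a vertex,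
  \<open>b0\<close>, \<open>b1\<close>, \<open>b2\<close> being the three independent ones.\<close>

definition cost_O where
  "cost_O z x0 x1 x2 y0 y1 y2 b0 b1 b2 =
     neqb z x0 + neqb z x1 + neqb z x2 + neqb x0 y0 + neqb x1 y1 + neqb x2 y2
     + (neqb b0 x0 + neqb b0 y1 + neqb b0 y2) + (neqb b1 x1 + neqb b1 y2 + neqb b1 y0)
     + (neqb b2 x2 + neqb b2 y0 + neqb b2 y1)"

definition cost_N where
  "cost_N p q l00 l01 l10 l11 a b c d =
     neqb p q + neqb p l00 + neqb p l01 + neqb q l10 + neqb q l11
     + (neqb a l00 + neqb a l10) + (neqb b l01 + neqb b l11) + (neqb c l01 + neqb c l10) + (neqb d l00 + neqb d l11)"

text \<open>The Petersen graph is 3-edge-connected.\<close>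

lemma cost_O_ge: "\<not> (b0 = b1 \<and> b1 = b2) \<Longrightarrow> 3 \<le> cost_O z x0 x1 x2 y0 y1 y2 b0 b1 b2"
  unfolding cost_O_def
  by (cases z; cases x0; cases x1; cases x2; cases y0; cases y1; cases y2; cases b0; cases b1; cases b2; simp)

text \<open>\<open>cost_N\<close> omits the Petersen edges between \<open>a\<close> and
  \<open>b\<close> and between \<open>c\<close> and \<open>d\<close>. If just one of them crosses,
  at least 3 - 1 edges are counted. In the second case neither crosses and both sides contain an
  edge, so the cut has at least 4 edges.\<close>

lemma cost_N_ge:
  "(a = b) \<noteq> (c = d) \<Longrightarrow> 2 \<le> cost_N p q l00 l01 l10 l11 a b c d"
  "a = b \<Longrightarrow> c = d \<Longrightarrow> a \<noteq> c \<Longrightarrow> 4 \<le> cost_N p q l00 l01 l10 l11 a b c d"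
  unfolding cost_N_def
  by (cases p; cases q; cases l00; cases l01; cases l10; cases l11; cases a; cases b; cases c; cases d; simp)+

lemma sum_hexi: "(\<Sum>r\<in>UNIV. f r) = f (False, S0) + f (False, S1) + f (False, S2)
    + f (True, S0) + f (True, S1) + f (True, S2)" for f :: "hexi \<Rightarrow> nat"
proof -
  have "(UNIV :: hexi set) = {(False, S0), (False, S1), (False, S2), (True, S0), (True, S1), (True, S2)}"
    using UNIV_three by (auto simp: set_eq_iff)
  then show ?thesis unfolding \<open>UNIV = _\<close> by simp
qed

lemma hexagon_crossings:
  assumes "\<not> (\<forall>r. v r = v (False, S0))"
  shows "2 \<le> (\<Sum>r\<in>UNIV. neqb (v r) (v (hnext r)))"
proof -
  obtain h s where "v (h, s) \<noteq> v (False, S0)" using assms by fast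
  then show ?thesis unfolding sum_hexi
    by (cases "v (False, S0)"; cases "v (False, S1)"; cases "v (False, S2)";
        cases "v (True, S0)"; cases "v (True, S1)"; cases "v (True, S2)"; cases h; cases s) simp_all
qed

definition dipole_verts :: "hexi \<Rightarrow> tv set" where
  "dipole_verts r = {OZ r False, OX r False S0, OX r False S1, OX r False S2, OY r False S0, OY r False S1,
     OY r False S2, OZ r True, OX r True S0, OX r True S1, OX r True S2, OY r True S0, OY r True S1,
     OY r True S2, NP r False, NP r True, NL r False False, NL r False True, NL r True False, NL r True True}"

definition dipole_cost :: "(tv \<Rightarrow> bool) \<Rightarrow> (bv \<Rightarrow> bool) \<Rightarrow> hexi \<Rightarrow> nat" where
  "dipole_cost \<chi> \<beta> r =
     cost_O (\<chi> (OZ r False)) (\<chi> (OX r False S0)) (\<chi> (OX r False S1)) (\<chi> (OX r False S2))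
       (\<chi> (OY r False S0)) (\<chi> (OY r False S1)) (\<chi> (OY r False S2))
       (\<beta> (BI r False False)) (\<beta> (BI r False True)) (\<beta> (BT r))
   + cost_O (\<chi> (OZ r True)) (\<chi> (OX r True S0)) (\<chi> (OX r True S1)) (\<chi> (OX r True S2))
       (\<chi> (OY r True S0)) (\<chi> (OY r True S1)) (\<chi> (OY r True S2))
       (\<beta> (BI r True False)) (\<beta> (BI r True True)) (\<beta> (BT (hnext r)))
   + cost_N (\<chi> (NP r False)) (\<chi> (NP r True)) (\<chi> (NL r False False)) (\<chi> (NL r False True))
       (\<chi> (NL r True False)) (\<chi> (NL r True True))
       (\<beta> (BI r False False)) (\<beta> (BI r False True)) (\<beta> (BI r True False)) (\<beta> (BI r True True))"

text \<open>If the ends disagree, a copy counted by \<open>cost_O\<close> is split (3) or the two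
  inner pairs are separated from each other (4). If the ends agree but an inner vertex differs, both
  copies are split (3 + 3), or one is (3) and \<open>cost_N\<close> adds at least 2.\<close>

lemma dipole_cost_ge:
  "\<beta> (BT r) \<noteq> \<beta> (BT (hnext r)) \<Longrightarrow> 3 \<le> dipole_cost \<chi> \<beta> r"
  "\<beta> (BT r) = \<beta> (BT (hnext r)) \<Longrightarrow> \<beta> (BI r j e) \<noteq> \<beta> (BT r) \<Longrightarrow> 5 \<le> dipole_cost \<chi> \<beta> r"
proof -
  let ?O0 = "cost_O (\<chi> (OZ r False)) (\<chi> (OX r False S0)) (\<chi> (OX r False S1)) (\<chi> (OX r False S2))
       (\<chi> (OY r False S0)) (\<chi> (OY r False S1)) (\<chi> (OY r False S2))"
  let ?O1 = "cost_O (\<chi> (OZ r True)) (\<chi> (OX r True S0)) (\<chi> (OX r True S1)) (\<chi> (OX r True S2))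
       (\<chi> (OY r True S0)) (\<chi> (OY r True S1)) (\<chi> (OY r True S2))"
  let ?N = "cost_N (\<chi> (NP r False)) (\<chi> (NP r True)) (\<chi> (NL r False False)) (\<chi> (NL r False True))
       (\<chi> (NL r True False)) (\<chi> (NL r True True))"
  have cO: "3 \<le> ?O0 b0 b1 b2" "3 \<le> ?O1 b0 b1 b2" if "\<not> (b0 = b1 \<and> b1 = b2)" for b0 b1 b2
    by (rule cost_O_ge[OF that])+
  have cN: "(a = b) \<noteq> (c = d) \<Longrightarrow> 2 \<le> ?N a b c d" "a = b \<Longrightarrow> c = d \<Longrightarrow> a \<noteq> c \<Longrightarrow> 4 \<le> ?N a b c d" for a b c d
    by (rule cost_N_ge; assumption)+
  let ?a = "\<beta> (BI r False False)" and ?b = "\<beta> (BI r False True)" and ?c = "\<beta> (BI r True False)"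
    and ?d = "\<beta> (BI r True True)" and ?y = "\<beta> (BT r)" and ?z = "\<beta> (BT (hnext r))"
  note facts = cO(1)[of ?a ?b ?y] cO(2)[of ?c ?d ?z] cN[of ?a ?b ?c ?d]
  show "?y \<noteq> ?z \<Longrightarrow> 3 \<le> dipole_cost \<chi> \<beta> r"
  proof -
    assume "?y \<noteq> ?z"
    then consider "\<not> (?a = ?b \<and> ?b = ?y)" | "\<not> (?c = ?d \<and> ?d = ?z)" | "?a = ?b" "?c = ?d" "?a \<noteq> ?c"
      by auto
    then show ?thesis
    proof cases
      case 1
      then show ?thesis unfolding dipole_cost_def using facts(1) by linarith
    next
      case 2
      then show ?thesis unfolding dipole_cost_def using facts(2) by linarith
    next
      case 3
      then have "4 \<le> ?N ?a ?b ?c ?d" by (rule facts(4))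
      then show ?thesis unfolding dipole_cost_def by linarith
    qed
  qed
  show "?y = ?z \<Longrightarrow> \<beta> (BI r j e) \<noteq> ?y \<Longrightarrow> 5 \<le> dipole_cost \<chi> \<beta> r"
  proof -
    assume yz: "?y = ?z" and ne: "\<beta> (BI r j e) \<noteq> ?y"
    have "\<not> (?a = ?b \<and> ?b = ?y) \<or> \<not> (?c = ?d \<and> ?d = ?z)"
      using ne yz by (cases j; cases e) auto
    moreover have "5 \<le> dipole_cost \<chi> \<beta> r" if "\<not> (?a = ?b \<and> ?b = ?y)" "\<not> (?c = ?d \<and> ?d = ?z)"
      unfolding dipole_cost_def using facts(1,2) that by linarith
    moreover have "5 \<le> dipole_cost \<chi> \<beta> r" if h: "\<not> (?a = ?b \<and> ?b = ?y)" "?c = ?d \<and> ?d = ?z"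
    proof (cases "?a = ?b")
      case True
      then have "4 \<le> ?N ?a ?b ?c ?d" using facts(4) h yz by blast
      then show ?thesis unfolding dipole_cost_def using facts(1) h by linarith
    next
      case False
      then have "2 \<le> ?N ?a ?b ?c ?d" using facts(3) h by blast
      then show ?thesis unfolding dipole_cost_def using facts(1) h by linarith
    qed
    moreover have "5 \<le> dipole_cost \<chi> \<beta> r" if h: "?a = ?b \<and> ?b = ?y" "\<not> (?c = ?d \<and> ?d = ?z)"
    proof (cases "?c = ?d")
      case True
      then have "4 \<le> ?N ?a ?b ?c ?d" using facts(4) h yz by blast
      then show ?thesis unfolding dipole_cost_def using facts(2) h by linarith
    next
      case False
      then have "2 \<le> ?N ?a ?b ?c ?d" using facts(3) h by blast
      then show ?thesis unfolding dipole_cost_def using facts(2) h by linarith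
    qed
    ultimately show ?thesis by blast
  qed
qed

lemma card_diff_insert:
  "finite B \<Longrightarrow> a \<notin> B \<Longrightarrow> card (insert a B - A) = of_bool (a \<notin> A) + card (B - A)"
  by (simp add: insert_Diff_if)

lemma tree_cut_ge:
  assumes g: "5 \<le> g" and A: "A \<subseteq> tree_verts g"
  shows "(\<Sum>r\<in>UNIV. \<Sum>x\<in>dipole_verts r. if x \<in> A then card (tree_nbrs g x - A) else 0) \<le> card (cut (tree_nbrs g) A)"
proof -
  interpret sgraph "tree_verts g" "tree_nbrs g" by (rule sgraph_tree[OF g])
  let ?f = "\<lambda>x. if x \<in> A then card (tree_nbrs g x - A) else 0"
  have fin: "finite (dipole_verts r)" for r by (simp add: dipole_verts_def)
  have "(\<Sum>r\<in>UNIV. \<Sum>x\<in>dipole_verts r. ?f x) = (\<Sum>x\<in>(\<Union>r. dipole_verts r). ?f x)"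
    using fin by (intro sum.UNION_disjoint[symmetric]) (auto simp: dipole_verts_def)
  also have "\<dots> \<le> (\<Sum>x\<in>tree_verts g. ?f x)"
    by (intro sum_mono2 finite_tree_verts) (auto simp: dipole_verts_def tree_verts_def)
  also have "\<dots> = (\<Sum>x\<in>A. card (tree_nbrs g x - A))"
    using A by (simp add: sum.inter_restrict[OF finite_tree_verts, symmetric] Int_absorb1)
  also have "\<dots> = card (cut (tree_nbrs g) A)" by (rule card_cut_sum[OF A, symmetric])
  finally show ?thesis .
qed

lemma port_count:
  fixes P :: "bv \<Rightarrow> nat \<Rightarrow> bool"
  shows "card {(b, i). b \<in> UNIV \<and> i < n \<and> P b i} = (\<Sum>b\<in>UNIV. \<Sum>i<n. of_bool (P b i))"
proof -
  have "{(b, i). b \<in> UNIV \<and> i < n \<and> P b i} = (SIGMA b:UNIV. {i \<in> {..<n}. P b i})" by auto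
  then have "card {(b, i). b \<in> UNIV \<and> i < n \<and> P b i} = (\<Sum>b\<in>UNIV. card {i \<in> {..<n}. P b i})"
    by (simp add: card_SigmaI)
  then show ?thesis by (simp add: Int_def)
qed

lemma sum_bool: "(\<Sum>j\<in>UNIV. f j) = f False + f True" for f :: "bool \<Rightarrow> nat"
  by (simp add: UNIV_bool)

text \<open>Ports 3 to 5 of \<open>BT (hnext r)\<close> lead into dipole \<open>r\<close> and are
  charged there, by a shift around the hexagon.\<close>

lemma port_cut_ge:
  "(\<Sum>r\<in>UNIV. (\<Sum>j\<in>UNIV. \<Sum>e\<in>UNIV. \<Sum>i<5. neqb (\<beta> (BI r j e)) (\<chi> (port (BI r j e) i)))
      + ((\<Sum>i<3. neqb (\<beta> (BT r)) (\<chi> (port (BT r) i)))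
      + (\<Sum>i<3. neqb (\<beta> (BT (hnext r))) (\<chi> (port (BT (hnext r)) (3 + i))))))
    \<le> card {(b, i). b \<in> UNIV \<and> i < g + 7 \<and> \<beta> b \<noteq> \<chi> (port b i)}"
proof -
  let ?h = "\<lambda>b i. neqb (\<beta> b) (\<chi> (port b i))"
  have "(\<Sum>r\<in>UNIV. \<Sum>i<3. ?h (BT (hnext r)) (3 + i)) = (\<Sum>r\<in>UNIV. \<Sum>i<3. ?h (BT r) (3 + i))"
    by (rule sum.reindex_bij_witness[of _ hprev hnext]) auto
  then have "(\<Sum>r\<in>UNIV. (\<Sum>j\<in>UNIV. \<Sum>e\<in>UNIV. \<Sum>i<5. ?h (BI r j e) i)
      + ((\<Sum>i<3. ?h (BT r) i) + (\<Sum>i<3. ?h (BT (hnext r)) (3 + i))))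
    = (\<Sum>r\<in>UNIV. (\<Sum>j\<in>UNIV. \<Sum>e\<in>UNIV. \<Sum>i<5. ?h (BI r j e) i) + ((\<Sum>i<3. ?h (BT r) i) + (\<Sum>i<3. ?h (BT r) (3 + i))))"
    by (simp add: sum.distrib)
  also have "\<dots> \<le> (\<Sum>r\<in>UNIV. (\<Sum>j\<in>UNIV. \<Sum>e\<in>UNIV. \<Sum>i<g + 7. ?h (BI r j e) i) + (\<Sum>i<g + 7. ?h (BT r) i))"
  proof (intro sum_mono add_mono)
    fix r j e
    show "(\<Sum>i<5. ?h (BI r j e) i) \<le> (\<Sum>i<g + 7. ?h (BI r j e) i)"
      by (intro sum_mono2) auto
    have "(\<Sum>i<3. ?h (BT r) i) + (\<Sum>i<3. ?h (BT r) (3 + i)) = (\<Sum>i<6. ?h (BT r) i)"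
      by (simp add: eval_nat_numeral)
    also have "\<dots> \<le> (\<Sum>i<g + 7. ?h (BT r) i)" by (intro sum_mono2) auto
    finally show "(\<Sum>i<3. ?h (BT r) i) + (\<Sum>i<3. ?h (BT r) (3 + i)) \<le> (\<Sum>i<g + 7. ?h (BT r) i)" .
  qed
  also have "\<dots> = card {(b, i). b \<in> UNIV \<and> i < g + 7 \<and> \<beta> b \<noteq> \<chi> (port b i)}"
    unfolding port_count sum_bv ..
  finally show ?thesis .
qed

lemma dipole_cost_eq:
  "(\<Sum>x\<in>dipole_verts r. if x \<in> A then card (tree_nbrs g x - A) else 0)
     + ((\<Sum>j\<in>UNIV. \<Sum>e\<in>UNIV. \<Sum>i<5. neqb (\<beta> (BI r j e)) (port (BI r j e) i \<in> A))
      + ((\<Sum>i<3. neqb (\<beta> (BT r)) (port (BT r) i \<in> A))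
      + (\<Sum>i<3. neqb (\<beta> (BT (hnext r))) (port (BT (hnext r)) (3 + i) \<in> A))))
   = dipole_cost (\<lambda>t. t \<in> A) \<beta> r"
proof -
  \<comment> \<open>\<open>cut\<close> lists pairs directed out of \<open>A\<close>, so a crossing
    edge is charged to its end in \<open>A\<close>; splitting the indicator by direction matches
    this.\<close>
  have split: "neqb p q = of_bool (p \<and> \<not> q) + of_bool (q \<and> \<not> p)" for p q by auto
  have cond: "(if p then of_bool q + n else 0) = of_bool (p \<and> q) + (if p then n else (0::nat))" for p q n by auto
  have cond0: "(if p then 0 else 0) = (0::nat)" for p by auto
  have tt: "(\<Sum>x\<in>dipole_verts r. if x \<in> A then card (tree_nbrs g x - A) else 0)
    = (let x = (\<lambda>t. t \<in> A) in
       neqb (x (OZ r False)) (x (OX r False S0)) + neqb (x (OZ r False)) (x (OX r False S1)) + neqb (x (OZ r False)) (x (OX r False S2))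
     + neqb (x (OX r False S0)) (x (OY r False S0)) + neqb (x (OX r False S1)) (x (OY r False S1)) + neqb (x (OX r False S2)) (x (OY r False S2))
     + (neqb (x (OZ r True)) (x (OX r True S0)) + neqb (x (OZ r True)) (x (OX r True S1)) + neqb (x (OZ r True)) (x (OX r True S2))
     + neqb (x (OX r True S0)) (x (OY r True S0)) + neqb (x (OX r True S1)) (x (OY r True S1)) + neqb (x (OX r True S2)) (x (OY r True S2)))
     + (neqb (x (NP r False)) (x (NP r True)) + neqb (x (NP r False)) (x (NL r False False)) + neqb (x (NP r False)) (x (NL r False True))
     + neqb (x (NP r True)) (x (NL r True False)) + neqb (x (NP r True)) (x (NL r True True))))"
    unfolding dipole_verts_def Let_def split
    by (simp add: card_diff_insert cond cond0 del: card_Diff_insert cong: if_cong)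
  show ?thesis
    unfolding tt dipole_cost_def cost_O_def cost_N_def sum_bool Let_def
    by (simp add: eval_nat_numeral)
qed

text \<open>If the hexagon vertices are not all on one side, at least two dipoles are crossed, at
  cost 3 each; a deviating vertex inside a dipole costs 5.\<close>

lemma tree_cut:
  assumes g: "5 \<le> g" and A: "A \<subseteq> tree_verts g"
    and le: "card (cut (tree_nbrs g) A)
      + card {(b, i). b \<in> UNIV \<and> i < g + 7 \<and> (b \<in> S) \<noteq> (port b i \<in> A)} \<le> 4"
  shows "S = {} \<or> S = UNIV"
proof -
  let ?\<beta> = "\<lambda>b. b \<in> S"
  let ?D = "dipole_cost (\<lambda>t. t \<in> A) ?\<beta>"
  have "(\<Sum>r\<in>UNIV. ?D r) \<le> 4"
    using le tree_cut_ge[OF g A] port_cut_ge[where \<beta> = ?\<beta> and \<chi> = "\<lambda>t. t \<in> A" and g = g]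
    unfolding dipole_cost_eq[where A = A and g = g and \<beta> = ?\<beta>, symmetric] by (simp only: sum.distrib)
  have each: "?D r \<le> 4" for r
    using member_le_sum[of r UNIV ?D] \<open>(\<Sum>r\<in>UNIV. ?D r) \<le> 4\<close> by simp
  have "\<forall>r. ?\<beta> (BT r) = ?\<beta> (BT (False, S0))"
  proof (rule ccontr)
    assume "\<not> ?thesis"
    then have "2 \<le> (\<Sum>r\<in>UNIV. neqb (?\<beta> (BT r)) (?\<beta> (BT (hnext r))))"
      by (rule hexagon_crossings)
    moreover have "3 * neqb (?\<beta> (BT r)) (?\<beta> (BT (hnext r))) \<le> ?D r" for r
      using dipole_cost_ge(1)[where \<beta> = ?\<beta> and r = r] by simp
    then have "(\<Sum>r\<in>UNIV. 3 * neqb (?\<beta> (BT r)) (?\<beta> (BT (hnext r)))) \<le> (\<Sum>r\<in>UNIV. ?D r)"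
      by (rule sum_mono)
    ultimately show False
      using \<open>(\<Sum>r\<in>UNIV. ?D r) \<le> 4\<close> unfolding sum_distrib_left[symmetric] by linarith
  qed
  then have bt: "?\<beta> (BT r) = ?\<beta> (BT (False, S0))" for r by blast
  have "?\<beta> (BI r j e) = ?\<beta> (BT (False, S0))" for r j e
  proof (rule ccontr)
    assume "?\<beta> (BI r j e) \<noteq> ?\<beta> (BT (False, S0))"
    then have "5 \<le> ?D r" using bt[of r] bt[of "hnext r"] by (intro dipole_cost_ge(2)) auto
    then show False using each[of r] by linarith
  qed
  then have "?\<beta> b = ?\<beta> (BT (False, S0))" for b using bt by (cases b) auto
  then show ?thesis by blast
qed

section \<open>Absence of flows on the skeleton\<close>

lemma dipole_flow:
  fixes a b c d p q :: "bit \<times> bit"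
  assumes "a + b + p = 0" "c + d + q = 0" "a \<noteq> 0 \<or> b \<noteq> 0" "c \<noteq> 0 \<or> d \<noteq> 0" "a + b + c + d = 0"
    "\<not> (a + b = 0 \<and> c + d = 0 \<and> a \<noteq> 0 \<and> c \<noteq> 0)"
  shows "p + q = 0" "p \<noteq> 0"
  using assms unfolding pair_sum4 unfolding pair_sum3 unfolding pair_sum2 pair_nonzero by sat+

lemma sum_lessThan_add: "(\<Sum>i<m + n. f i) = (\<Sum>i<m. f i) + (\<Sum>k<n. f (m + k))"
  for f :: "nat \<Rightarrow> 'a :: comm_monoid_add" and m n :: nat
  by (induction n) (simp_all add: add.assoc)

lemma tree_noflow:
  fixes F :: "tv \<Rightarrow> tv \<Rightarrow> bit \<times> bit"
  assumes g: "5 \<le> g"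
    and F: "\<And>t t'. t \<in> tree_verts g \<Longrightarrow> t' \<in> tree_nbrs g t \<Longrightarrow> F t t' = F t' t \<and> F t t' \<noteq> 0"
    and x: "\<And>b i. b \<in> UNIV \<Longrightarrow> i < g + 7 \<Longrightarrow> x b i \<noteq> 0"
    and teq: "\<And>t. t \<in> tree_verts g \<Longrightarrow> (\<Sum>t'\<in>tree_nbrs g t. F t t')
      + (\<Sum>(b, i)\<in>{(b, i). b \<in> UNIV \<and> i < g + 7 \<and> port b i = t}. x b i) = 0"
    and beq: "\<And>b. b \<in> UNIV \<Longrightarrow> (\<Sum>i<g + 7. x b i) = 0"
  shows False
proof -
  have eq: "(\<Sum>t'\<in>tree_nbrs g t. F t t') + (\<Sum>(b, i)\<in>ports_at t. x b i) = 0"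
    if "t \<in> tree_verts g" for t
    using teq[OF that] unfolding ports_at_eq[OF that] .
  have T: "\<not> (\<exists>b k. t = CC b k) \<Longrightarrow> t \<in> tree_verts g" for t by (auto simp: tree_verts_def)
  have xn: "x b i \<noteq> 0" if "i < 7" for b i using x that by simp
  \<comment> \<open>Conservation summed over the attached circuit shows that its ports carry total
    0, so the first \<open>base b\<close> ports also sum to 0.\<close>
  have bsum: "(\<Sum>i<base b. x b i) = 0" for b
  proof -
    let ?C = "CC b ` {..<circ g b}"
    interpret T: sgraph "tree_verts g" "tree_nbrs g" by (rule sgraph_tree[OF g])
    have CT: "?C \<subseteq> tree_verts g" by (auto simp: tree_verts_def)
    have c0: "0 < circ g b" using circ_ge[of g b] g by linarith
    interpret C: sgraph ?C "tree_nbrs g"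
    proof
      show "finite ?C" by simp
      show "tree_nbrs g t \<subseteq> ?C" if "t \<in> ?C" for t using that c0 by auto
      show "t \<notin> tree_nbrs g t" if "t \<in> ?C" for t using that T.irr CT by blast
      show "t \<in> tree_nbrs g t'" if "t \<in> ?C" "t' \<in> tree_nbrs g t" for t t'
        using T.symN[OF subsetD[OF CT that(1)] that(2)] .
    qed
    have "(\<Sum>t\<in>?C. \<Sum>t'\<in>tree_nbrs g t. F t t') = 0"
    proof (rule C.symmetric_sum)
      show "F t t' = F t' t" if "t \<in> ?C" "t' \<in> tree_nbrs g t" for t t'
        using F[OF subsetD[OF CT that(1)] that(2)] by blast
    qed
    moreover have "(\<Sum>t\<in>?C. \<Sum>t'\<in>tree_nbrs g t. F t t') = (\<Sum>k<circ g b. \<Sum>t'\<in>tree_nbrs g (CC b k). F (CC b k) t')"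
      by (subst sum.reindex) (auto simp: inj_on_def)
    moreover have "(\<Sum>t'\<in>tree_nbrs g (CC b k). F (CC b k) t') + x b (base b + k) = 0" if "k < circ g b" for k
      using eq[of "CC b k"] that by (simp add: tree_verts_def)
    then have "(\<Sum>k<circ g b. (\<Sum>t'\<in>tree_nbrs g (CC b k). F (CC b k) t') + x b (base b + k)) = 0"
      by (intro sum.neutral) blast
    ultimately have "(\<Sum>k<circ g b. x b (base b + k)) = 0"
      by (simp add: sum.distrib)
    moreover have "g + 7 = base b + circ g b" using base_le[of b] by (simp add: circ_def)
    ultimately show ?thesis using beq[of b] by (simp add: sum_lessThan_add)
  qed
  have BI: "x (BI r j e) 0 + x (BI r j e) 1 + x (BI r j e) 2 + (x (BI r j e) 3 + x (BI r j e) 4) = 0" for r j e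
    using bsum[of "BI r j e"] by (simp add: eval_nat_numeral add.assoc)
  have BT: "x (BT r) 0 + x (BT r) 1 + x (BT r) 2 + (x (BT r) 3 + x (BT r) 4 + x (BT r) 5) + x (BT r) 6 = 0" for r
    using bsum[of "BT r"] by (simp add: eval_nat_numeral add.assoc)
  have Fn: "F t t' \<noteq> 0" if "\<not> (\<exists>b k. t = CC b k)" "t' \<in> tree_nbrs g t" for t t'
    using F[OF T[OF that(1)] that(2)] by blast
  have Fs: "F t t' = F t' t" if "\<not> (\<exists>b k. t = CC b k)" "t' \<in> tree_nbrs g t" for t t'
    using F[OF T[OF that(1)] that(2)] by blast
  \<comment> \<open>\<open>\<phi> r\<close> is what \<open>BT r\<close> sends into dipole
    \<open>r\<close>, \<open>\<psi> r\<close> what it receives from dipole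
    \<open>hprev r\<close>.\<close>
  define \<phi> where "\<phi> r = x (BT r) 0 + x (BT r) 1 + x (BT r) 2" for r
  define \<psi> where "\<psi> r = x (BT r) 3 + x (BT r) 4 + x (BT r) 5" for r
  have OZ: "F (OZ r j) (OX r j S0) + F (OZ r j) (OX r j S1) + F (OZ r j) (OX r j S2) = 0" for r j
    using eq[OF T, of "OZ r j"] by (simp add: add.assoc)
  have OX: "F (OZ r j) (OX r j s) + F (OX r j s) (OY r j s) + (\<Sum>(b, i)\<in>ports_at (OX r j s). x b i) = 0" for r j s
    using eq[OF T, of "OX r j s"] Fs[of "OZ r j" "OX r j s"] by (cases s) (simp_all add: add.assoc)
  have OY: "F (OX r j s) (OY r j s) + (\<Sum>(b, i)\<in>ports_at (OY r j s). x b i) = 0" for r j s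
    using eq[OF T, of "OY r j s"] Fs[of "OX r j s" "OY r j s"] by simp
  \<comment> \<open>By conservation at \<open>BI r j e\<close>, ports 3 and 4 carry the same total
    as the edges at the deleted vertex, so the sums in \<open>petersen_independent\<close> are the
    values handed on to the second Petersen graph and to the hexagon.\<close>
  have O: "(x (BI r j False) 3 + x (BI r j False) 4) + (x (BI r j True) 3 + x (BI r j True) 4)
      + (if j then \<psi> (hnext r) else \<phi> r) = 0 \<and>
      (x (BI r j False) 3 + x (BI r j False) 4 \<noteq> 0 \<or> x (BI r j True) 3 + x (BI r j True) 4 \<noteq> 0)" for r j
  proof -
    define p where "p i = (if j then x (BT (hnext r)) (3 + i) else x (BT r) i)" for i
    have s2: "(if j then \<psi> (hnext r) else \<phi> r) = p 0 + p 1 + p 2"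
      by (simp add: p_def \<phi>_def \<psi>_def)
    have pn: "p 0 \<noteq> 0" "p 1 \<noteq> 0" "p 2 \<noteq> 0" by (simp_all add: p_def xn)
    note P = petersen_independent[of "F (OZ r j) (OX r j S0)" "F (OZ r j) (OX r j S1)" "F (OZ r j) (OX r j S2)"
        "F (OX r j S0) (OY r j S0)" "F (OX r j S1) (OY r j S1)" "F (OX r j S2) (OY r j S2)"
        "x (BI r j False) 0" "x (BI r j False) 1" "x (BI r j False) 2"
        "x (BI r j True) 0" "x (BI r j True) 1" "x (BI r j True) 2" "p 0" "p 1" "p 2"
        "x (BI r j False) 3 + x (BI r j False) 4" "x (BI r j True) 3 + x (BI r j True) 4" "p 0 + p 1 + p 2"]
    have e: "F (OZ r j) (OX r j S0) + F (OX r j S0) (OY r j S0) + x (BI r j False) 0 = 0"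
      "F (OZ r j) (OX r j S1) + F (OX r j S1) (OY r j S1) + x (BI r j True) 0 = 0"
      "F (OZ r j) (OX r j S2) + F (OX r j S2) (OY r j S2) + p 0 = 0"
      using OX[of r j S0] OX[of r j S1] OX[of r j S2] by (auto simp: p_def)
    have e': "F (OX r j S0) (OY r j S0) + x (BI r j True) 2 + p 1 = 0"
      "F (OX r j S1) (OY r j S1) + x (BI r j False) 1 + p 2 = 0"
      "F (OX r j S2) (OY r j S2) + x (BI r j False) 2 + x (BI r j True) 1 = 0"
      using OY[of r j S0] OY[of r j S1] OY[of r j S2] by (auto simp: p_def add.assoc)
    show ?thesis unfolding s2
      by (intro conjI; rule P) (simp_all add: Fn xn pn OZ e e' BI bit_pair_add_self del: One_nat_def)
  qed
  have N: "(x (BI r False False) 3 + x (BI r False False) 4) + (x (BI r False True) 3 + x (BI r False True) 4)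
      + (x (BI r True False) 3 + x (BI r True False) 4) + (x (BI r True True) 3 + x (BI r True True) 4) = 0 \<and>
      \<not> ((x (BI r False False) 3 + x (BI r False False) 4) + (x (BI r False True) 3 + x (BI r False True) 4) = 0 \<and>
        (x (BI r True False) 3 + x (BI r True False) 4) + (x (BI r True True) 3 + x (BI r True True) 4) = 0 \<and>
        x (BI r False False) 3 + x (BI r False False) 4 \<noteq> 0 \<and> x (BI r True False) 3 + x (BI r True False) 4 \<noteq> 0)" for r
  proof -
    note P = petersen_two_edges[of "F (NP r False) (NP r True)" "F (NP r False) (NL r False False)"
        "F (NP r False) (NL r False True)" "F (NP r True) (NL r True False)" "F (NP r True) (NL r True True)"
        "x (BI r False False) 3" "x (BI r False False) 4" "x (BI r False True) 3" "x (BI r False True) 4"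
        "x (BI r True False) 3" "x (BI r True False) 4" "x (BI r True True) 3" "x (BI r True True) 4"]
    have e: "F (NP r False) (NP r True) + F (NP r False) (NL r False False) + F (NP r False) (NL r False True) = 0"
      "F (NP r False) (NP r True) + F (NP r True) (NL r True False) + F (NP r True) (NL r True True) = 0"
      using eq[OF T, of "NP r False"] eq[OF T, of "NP r True"] Fs[of "NP r False" "NP r True"]
      by (simp_all add: add.assoc)
    have e': "F (NP r False) (NL r False False) + x (BI r False False) 3 + x (BI r True True) 3 = 0"
      "F (NP r False) (NL r False True) + x (BI r False True) 3 + x (BI r True False) 3 = 0"
      "F (NP r True) (NL r True False) + x (BI r False False) 4 + x (BI r True False) 4 = 0"
      "F (NP r True) (NL r True True) + x (BI r False True) 4 + x (BI r True True) 4 = 0"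
      using eq[OF T, of "NL r False False"] eq[OF T, of "NL r False True"]
        eq[OF T, of "NL r True False"] eq[OF T, of "NL r True True"]
        Fs[of "NP r False" "NL r False False"] Fs[of "NP r False" "NL r False True"]
        Fs[of "NP r True" "NL r True False"] Fs[of "NP r True" "NL r True True"]
      by (simp_all add: add.assoc)
    show ?thesis
      by (intro conjI; rule P) (simp_all add: Fn xn e e' bit_pair_add_self)
  qed
  \<comment> \<open>If \<open>\<phi> r\<close> were 0, so would be \<open>\<psi> (hnext r)\<close>.
    Both removed edges of the second Petersen graph would then have equal totals at their ends,
    nonzero by \<open>O\<close>, which \<open>N\<close> excludes. So the dipole acts as an edge with
    a nonzero value.\<close>
  have D: "\<phi> r + \<psi> (hnext r) = 0 \<and> \<phi> r \<noteq> 0" for r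
  proof -
    note o0 = O[of r False, unfolded if_False] and o1 = O[of r True, unfolded if_True] and n = N[of r]
    note D = dipole_flow[OF conjunct1[OF o0] conjunct1[OF o1] conjunct2[OF o0] conjunct2[OF o1]
        conjunct1[OF n] conjunct2[OF n]]
    show ?thesis using D by (rule conjI)
  qed
  have \<psi>: "\<psi> r = \<phi> (hprev r)" for r
  proof -
    have "\<phi> (hprev r) + \<psi> r = \<phi> (hprev r) + \<phi> (hprev r)"
      using D[of "hprev r"] by (simp add: bit_pair_add_self)
    then show ?thesis by simp
  qed
  have hex: "\<phi> r + \<phi> (hprev r) + x (BT r) 6 = 0" for r
    using BT[of r] \<psi>[of r] unfolding \<phi>_def \<psi>_def by simp
  have TL: "F TZ (TL s) + x (BT (False, s)) 6 + x (BT (True, s)) 6 = 0" for s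
    using eq[OF T, of "TL s"] Fs[of TZ "TL s"] by (cases s) (simp_all add: add.assoc)
  have TZ: "F TZ (TL S0) + F TZ (TL S1) + F TZ (TL S2) = 0"
    using eq[OF T, of TZ] by (simp add: add.assoc)
  show False
    \<comment> \<open>The hexagon is listed in the order of \<open>hnext\<close>, starting at
      \<open>(False, S0)\<close>.\<close>
    by (rule petersen_hexagon[of "\<phi> (False, S0)" "\<phi> (True, S1)" "\<phi> (False, S2)" "\<phi> (True, S0)" "\<phi> (False, S1)" "\<phi> (True, S2)"
        "x (BT (False, S0)) 6" "x (BT (True, S1)) 6" "x (BT (False, S2)) 6" "x (BT (True, S0)) 6"
        "x (BT (False, S1)) 6" "x (BT (True, S2)) 6" "F TZ (TL S0)" "F TZ (TL S1)" "F TZ (TL S2)"])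
      (use hex[of "(False, S0)"] hex[of "(True, S1)"] hex[of "(False, S2)"] hex[of "(True, S0)"]
        hex[of "(False, S1)"] hex[of "(True, S2)"] TL[of S0] TL[of S1] TL[of S2] TZ D Fn[of TZ] xn
       in \<open>simp_all add: add_ac\<close>)
qed

lemma skeleton_tree:
  assumes g: "5 \<le> g"
  shows "skeleton (tree_verts g) (tree_nbrs g) UNIV port (g + 7) g"
proof (rule skeleton.intro[OF sgraph_tree[OF g]], unfold_locales)
  show "finite (UNIV :: bv set)" by simp
  show "port b i \<in> tree_verts g" if "i < g + 7" for b i
    using that by (cases b) (auto simp: tree_verts_def circ_def)
  show "card (tree_nbrs g t) + card {(b, i). b \<in> UNIV \<and> i < g + 7 \<and> port b i = t} = 3"
    if "t \<in> tree_verts g" for t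
    using card_ports_at[OF that] g unfolding ports_at_eq[OF that] by simp
  show "\<exists>b\<in>UNIV. \<exists>I\<subseteq>{..<g + 7}. inj_on (port b) I \<and> port b ` I \<subseteq> Z \<and> g \<le> card I"
    if "Z \<subseteq> tree_verts g" "core (tree_nbrs g) Z" for Z
    by (rule tree_core[OF g that])
  show "S = {} \<or> S = UNIV" if "A \<subseteq> tree_verts g" "card (cut (tree_nbrs g) A)
      + card {(b, i). b \<in> UNIV \<and> i < g + 7 \<and> (b \<in> S) \<noteq> (port b i \<in> A)} \<le> 4" for A S
    by (rule tree_cut[OF g that])
  \<comment> \<open>\<open>BT\<close> has base 7, so its attached circuit has length exactly
    \<open>g\<close>.\<close>
  show "\<exists>u. inj_on u {..<g} \<and> (\<forall>i<g. u i \<in> tree_verts g \<and> u (Suc i mod g) \<in> tree_nbrs g (u i))"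
    by (rule exI[of _ "CC (BT (False, S0))"]) (simp add: inj_on_def tree_verts_def circ_def)
  show "5 \<le> g" by (rule g)
qed (rule tree_noflow[OF g]; assumption)

section \<open>Snarks of prescribed girth\<close>

text \<open>Carries the snark to natural numbers, the vertex type in the theorem.\<close>

lemma (in snark_sgraph) transport:
  fixes f :: "'a \<Rightarrow> 'b"
  assumes f: "inj_on f V"
  shows "\<exists>N'. snark_sgraph (f ` V) N' g"
proof -
  define N' where "N' y = f ` N (inv_into V f y)" for y
  have Nf: "N' (f x) = f ` N x" if "x \<in> V" for x
    using f that by (simp add: N'_def)
  have injN: "inj_on f A" if "A \<subseteq> V" for A using f that by (rule inj_on_subset)
  have memf: "f x \<in> f ` A \<longleftrightarrow> x \<in> A" if "x \<in> V" "A \<subseteq> V" for x A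
    using inj_on_image_mem_iff[OF f] that by blast
  have int: "card (N' (f x) \<inter> f ` Z) = card (N x \<inter> Z)" if "x \<in> V" "Z \<subseteq> V" for x Z
  proof -
    have "N' (f x) \<inter> f ` Z = f ` (N x \<inter> Z)"
      using that nbr inj_on_image_Int[OF f] by (simp add: Nf)
    then show ?thesis using injN[of "N x \<inter> Z"] that by (simp add: card_image le_infI2)
  qed
  have core: "core N' (f ` Z) \<longleftrightarrow> core N Z" if "Z \<subseteq> V" for Z
    unfolding core_def using int[OF _ that] that by (simp add: subset_iff)
  have cyc: "cyclic N A" if A: "A \<subseteq> V" "cyclic N' (f ` A)" for A
  proof -
    obtain Z where Z: "Z \<subseteq> f ` A" "core N' Z" using A(2) unfolding cyclic_def by blast
    then obtain Y where Y: "Y \<subseteq> A" "Z = f ` Y" by (meson subset_imageE)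
    then show ?thesis using core[of Y] Z A(1) unfolding cyclic_def by (intro exI[of _ Y]) auto
  qed
  have cut: "card (cut N' (f ` A)) = card (cut N A)" if A: "A \<subseteq> V" for A
  proof -
    have "cut N' (f ` A) = map_prod f f ` cut N A"
    proof (intro set_eqI iffI)
      fix p assume "p \<in> cut N' (f ` A)"
      then obtain x y where "p = (f x, f y)" "x \<in> A" "y \<in> N x" "f y \<notin> f ` A"
        using A by (auto simp: cut_def Nf subset_iff)
      then show "p \<in> map_prod f f ` cut N A" by (force simp: cut_def)
    next
      fix p assume "p \<in> map_prod f f ` cut N A"
      then obtain x y where p: "p = (f x, f y)" "x \<in> A" "y \<in> N x" "y \<notin> A" by (auto simp: cut_def)
      then have "x \<in> V" "y \<in> V" using A nbr by blast+
      then show "p \<in> cut N' (f ` A)" using p memf[OF _ A] by (auto simp: cut_def Nf)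
    qed
    moreover have "cut N A \<subseteq> V \<times> V" using A nbr by (auto simp: cut_def)
    then have "inj_on (map_prod f f) (cut N A)"
      using map_prod_inj_on[OF f f] inj_on_subset by blast
    ultimately show ?thesis by (simp add: card_image)
  qed
  have "snark_sgraph (f ` V) N' g"
  proof
    show "finite (f ` V)" using fin by simp
    show "N' y \<subseteq> f ` V" if "y \<in> f ` V" for y
    proof -
      obtain x where "x \<in> V" "y = f x" using \<open>y \<in> f ` V\<close> by blast
      then show ?thesis using image_mono[OF nbr[of x], of f] by (simp add: Nf)
    qed
    show "y \<notin> N' y" if "y \<in> f ` V" for y
      using that irr nbr memf by (auto simp: Nf)
    show "y \<in> N' z" if yz: "y \<in> f ` V" "z \<in> N' y" for y z
    proof -
      obtain x w where "y = f x" "z = f w" "x \<in> V" "w \<in> N x" using yz by (auto simp: Nf)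
      then show ?thesis using Nf[of w] nbr symN by blast
    qed
    show "card (N' y) = 3" if "y \<in> f ` V" for y
      using that cub injN[OF nbr] by (auto simp: Nf card_image)
    show "f ` V \<noteq> {}" using ne by simp
    show "\<not> cyclic N' A \<or> \<not> cyclic N' (f ` V - A)" if A: "A \<subseteq> f ` V" "card (cut N' A) \<le> 4" for A
    proof -
      obtain B where B: "B \<subseteq> V" "A = f ` B" using A(1) by (meson subset_imageE)
      have "f ` V - f ` B = f ` (V - B)" using inj_on_image_set_diff[OF f] B by blast
      then show ?thesis using cyc5[of B] cut[of B] cyc[of B] cyc[of "V - B"] A B by auto
    qed
    show "g \<le> card Z" if Z: "Z \<subseteq> f ` V" "core N' Z" for Z
    proof -
      obtain Y where Y: "Y \<subseteq> V" "Z = f ` Y" using Z(1) by (meson subset_imageE)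
      then show ?thesis using core_card[of Y] core[of Y] Z(2) injN[of Y] by (simp add: card_image)
    qed
    show "\<not> nz_flow (f ` V) N' c" for c
    proof
      assume c: "nz_flow (f ` V) N' c"
      have "nz_flow V N (\<lambda>x y. c (f x) (f y))"
        unfolding nz_flow_def
      proof (intro conjI ballI)
        fix x assume x: "x \<in> V"
        have "(\<Sum>y\<in>N' (f x). c (f x) y) = 0" using c x unfolding nz_flow_def by blast
        then show "(\<Sum>y\<in>N x. c (f x) (f y)) = 0"
          using injN[OF nbr[OF x]] by (simp add: Nf[OF x] sum.reindex)
        fix y assume "y \<in> N x"
        then have "f y \<in> N' (f x)" using x by (simp add: Nf)
        then show "c (f x) (f y) = c (f y) (f x)" "c (f x) (f y) \<noteq> 0"
          using c x unfolding nz_flow_def by blast+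
      qed
      then show False using noflow by blast
    qed
    obtain u where u: "inj_on u {..<g}" "\<And>i. i < g \<Longrightarrow> u i \<in> V \<and> u (Suc i mod g) \<in> N (u i)"
      using has_circuit by blast
    have "u ` {..<g} \<subseteq> V" using u(2) by auto
    then have "inj_on (f \<circ> u) {..<g}" using comp_inj_on[OF u(1)] injN by blast
    then show "\<exists>u. inj_on u {..<g} \<and> (\<forall>i<g. u i \<in> f ` V \<and> u (Suc i mod g) \<in> N' (u i))"
      using u(2) by (intro exI[of _ "f \<circ> u"]) (auto simp: Nf)
    show "3 \<le> g" by (rule g3)
  qed
  then show ?thesis by blast
qed

lemma large_snark_sgraphs:
  assumes g: "5 \<le> g"
  shows "\<exists>(V :: nat set) N. snark_sgraph V N g \<and> n \<le> card V"
proof -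
  \<comment> \<open>\<open>g + 9\<close> is the least \<open>L\<close> that \<open>dL\<close> allows
    for \<open>g + 7\<close> ports, and it satisfies \<open>gL\<close>.\<close>
  obtain W :: "(nat list \<Rightarrow> nat list) set" and M \<pi>
    where W: "pole W M \<pi> (g + 7) (g + 9)" "n \<le> card W"
    using large_poles[of "g + 7" "g + 9" n] by auto
  interpret S: skeleton "tree_verts g" "tree_nbrs g" UNIV port "g + 7" g
    by (rule skeleton_tree[OF g])
  interpret W: pole W M \<pi> "g + 7" "g + 9" by (rule W(1))
  interpret E: expansion "tree_verts g" "tree_nbrs g" UNIV port "g + 7" g W M \<pi> "g + 9"
    by unfold_locales simp
  obtain f :: "_ \<Rightarrow> nat" where f: "inj_on f E.XV" using finite_imp_inj_to_nat_seg[OF E.X.fin] by blast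
  then obtain N' where "snark_sgraph (f ` E.XV) N' g" using E.X.transport by blast
  moreover have "n \<le> card (f ` E.XV)" using W(2) E.card_XV f by (simp add: card_image)
  ultimately show ?thesis by blast
qed

lemma iso_card: "mgraph_iso G H \<Longrightarrow> card (verts G) = card (verts H)"
  unfolding mgraph_iso_def using bij_betw_same_card by blast

theorem theorem5p3:
  fixes g :: nat
  assumes "g \<ge> 5"
  shows "\<exists>S :: (nat, nat) mgraph set.
           infinite S \<and>
           pairwise (\<lambda>G H. \<not> mgraph_iso G H) S \<and>
           (\<forall>G\<in>S. snark G \<and> cyclically_edge_connected 5 G \<and> girth G = enat g)"
proof -
  define P where "P G \<longleftrightarrow> snark G \<and> cyclically_edge_connected 5 G \<and> girth G = enat g"
    for G :: "(nat, nat) mgraph"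
  define C where "C = (\<lambda>G. card (verts G)) ` Collect P"
  have "\<exists>m\<in>C. n \<le> m" for n
  proof -
    obtain V :: "nat set" and N where V: "snark_sgraph V N g" "n \<le> card V"
      using large_snark_sgraphs[OF assms] by blast
    interpret nat_snark V N g using V(1) by (simp add: nat_snark_def)
    have "P G" using snark_G cyclically_5 girth_G by (simp add: P_def)
    then show ?thesis using V(2) unfolding C_def by (intro bexI[of _ "card V"]) force+
  qed
  then have "infinite C" unfolding infinite_nat_iff_unbounded_le by blast
  \<comment> \<open>One snark for each order that occurs; isomorphic graphs have equal order, so
    distinct picks are not isomorphic.\<close>
  define pick where "pick m = (SOME G. P G \<and> card (verts G) = m)" for m
  have pick: "P (pick m) \<and> card (verts (pick m)) = m" if "m \<in> C" for m
    unfolding pick_def by (rule someI_ex) (use that in \<open>auto simp: C_def\<close>)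
  have "inj_on pick C" using pick by (metis inj_onI)
  then have "infinite (pick ` C)" using \<open>infinite C\<close> finite_imageD by blast
  moreover have "pairwise (\<lambda>G H. \<not> mgraph_iso G H) (pick ` C)"
    unfolding pairwise_def
  proof (intro ballI impI notI)
    fix G H assume "G \<in> pick ` C" "H \<in> pick ` C" "G \<noteq> H" "mgraph_iso G H"
    then obtain m n where mn: "m \<in> C" "n \<in> C" "G = pick m" "H = pick n" by blast
    then have "m = n" using iso_card[OF \<open>mgraph_iso G H\<close>] pick[of m] pick[of n] by simp
    then show False using mn \<open>G \<noteq> H\<close> by simp
  qed
  moreover have "\<forall>G\<in>pick ` C. P G" using pick by blast
  ultimately show ?thesis unfolding P_def by blast
qed

end
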